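(* Let $p>0$, let $\mathbb{T}$ be a $p$-periodic time scale and let $A:\mathbb{T}\to\mathbb{R}^{n\times n}$ be regressive and $p$-periodic. Then the transition matrix $\Phi_A$ can be written in the form $$\Phi_A(t,\tau)=L(t)\,e_R(t,\tau)\,L^{-1}(\tau)\quad\text{for all }t,\tau\in\mathbb{T},$$ where $R:\mathbb{T}\to\mathbb{C}^{n\times n}$ and $L\in C^1_{\mathrm{rd}}(\mathbb{T},\mathbb{C}^{n\times n})$ are both $p$-periodic and invertible at each $t\in\mathbb{T}$.
   Context: A time scale $\mathbb{T}$ is a nonempty closed subset of $\mathbb{R}$; $\sigma(t)=\inf\{s\in\mathbb{T}:s>t\}$, $\mu(t)=\sigma(t)-t$, and $f^\Delta$ denotes the delta (Hilger) derivative. $f$ is rd-continuous if it is continuous at right-dense points and has finite left-sided limits at left-dense points; $C^1_{\mathrm{rd}}$ is the set of delta differentiable functions with rd-continuous delta derivative. $\mathbb{T}$ is $p$-periodic if for all $t\in\mathbb{T}$: $t+p\in\mathbb{T}$ and $\mu(t)=\mu(t+p)$; it is assumed that $0\le\mu(t)\le p$. A function $F$ on $\mathbb{T}$ is $p$-periodic if $F(t+p)=F(t)$ for all $t\in\mathbb{T}$. A matrix function $A$ is regressive if it is rd-continuous and $I+\mu(t)A(t)$ is invertible for all $t$. $\Phi_A(t,\tau)$ is the transition matrix: the unique solution of $X^\Delta=A(t)X$, $X(\tau)=I$. The notation $e_R(t,\tau)$ is used for the transition matrix $\Phi_R(t,\tau)$ of a regressive $R$ that commutes with its integral, i.e. $R(t)\int_s^tR(\tau)\Delta\tau=\int_s^tR(\tau)\Delta\tau\,R(t)$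 for all $s,t$; writing $e_R$ presupposes that $R$ has these properties.
   Formalization: Invertibility of R(t) is claimed only where μ(t)<p or A(t) is invertible; if μ(t)=p then R(t) is similar to A(t), so the claim as stated fails, e.g. for T=ℤ, p=1, A=0, which forces R=0. *)

theory Defs
  imports "HOL-Analysis.Analysis"
begin

text \<open>
  A function on a time scale \<open>T\<close> is represented by a total function on the reals of which only
  the values on \<open>T\<close> matter.
\<close>

definition time_scale :: "real set \<Rightarrow> bool" where
  "time_scale T \<longleftrightarrow> T \<noteq> {} \<and> closed T"

text \<open>At a maximum of \<open>T\<close> the usual convention \<open>inf {} = sup T\<close> gives \<open>\<sigma>(t) = t\<close>.\<close>

definition fwd_jump :: "real set \<Rightarrow> real \<Rightarrow> real" where
  "fwd_jump T t = (if \<exists>s\<in>T. t < s then Inf {s \<in> T. t < s} else t)"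

definition graininess :: "real set \<Rightarrow> real \<Rightarrow> real" where
  "graininess T t = fwd_jump T t - t"

definition right_dense :: "real set \<Rightarrow> real \<Rightarrow> bool" where
  "right_dense T t \<longleftrightarrow> (\<exists>s\<in>T. t < s) \<and> fwd_jump T t = t"

definition left_dense :: "real set \<Rightarrow> real \<Rightarrow> bool" where
  "left_dense T t \<longleftrightarrow> (\<exists>s\<in>T. s < t) \<and> Sup {s \<in> T. s < t} = t"

definition rd_continuous :: "real set \<Rightarrow> (real \<Rightarrow> 'a::topological_space) \<Rightarrow> bool" where
  "rd_continuous T f \<longleftrightarrow>
     (\<forall>t\<in>T. right_dense T t \<longrightarrow> continuous (at t within T) f) \<and>
     (\<forall>t\<in>T. left_dense T t \<longrightarrow> (\<exists>l. (f \<longlongrightarrow> l) (at t within (T \<inter> {..<t}))))"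

text \<open>
  The Hilger derivative.  At a left-scattered maximum of \<open>T\<close> every \<open>d\<close> satisfies this condition,
  so requiring it on all of \<open>T\<close> is the same as requiring it on \<open>T\<close> without such a maximum, which
  is the usual domain of the derivative.
\<close>

definition has_delta_derivative ::
    "real set \<Rightarrow> (real \<Rightarrow> 'a::real_normed_vector) \<Rightarrow> 'a \<Rightarrow> real \<Rightarrow> bool" where
  "has_delta_derivative T f d t \<longleftrightarrow>
     (\<forall>\<epsilon>>0. \<exists>\<delta>>0. \<forall>s\<in>T. \<bar>s - t\<bar> < \<delta> \<longrightarrow>
        norm (f (fwd_jump T t) - f s - (fwd_jump T t - s) *\<^sub>R d) \<le> \<epsilon> * \<bar>fwd_jump T t - s\<bar>)"

definition C1_rd :: "real set \<Rightarrow> (real \<Rightarrow> 'a::real_normed_vector) \<Rightarrow> bool" where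
  "C1_rd T f \<longleftrightarrow> (\<exists>g. (\<forall>t\<in>T. has_delta_derivative T f (g t) t) \<and> rd_continuous T g)"

text \<open>The Cauchy delta integral, via delta antiderivatives.\<close>

definition delta_integral ::
    "real set \<Rightarrow> (real \<Rightarrow> 'a::real_normed_vector) \<Rightarrow> real \<Rightarrow> real \<Rightarrow> 'a" where
  "delta_integral T f s t =
     (THE I. \<exists>F. (\<forall>r\<in>T. has_delta_derivative T F (f r) r) \<and> I = F t - F s)"

definition periodic_time_scale :: "real \<Rightarrow> real set \<Rightarrow> bool" where
  "periodic_time_scale p T \<longleftrightarrow> time_scale T \<and>
     (\<forall>t\<in>T. t + p \<in> T \<and> graininess T t = graininess T (t + p) \<and>
             0 \<le> graininess T t \<and> graininess T t \<le> p)"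

definition periodic_on :: "real \<Rightarrow> real set \<Rightarrow> (real \<Rightarrow> 'a) \<Rightarrow> bool" where
  "periodic_on p T F \<longleftrightarrow> (\<forall>t\<in>T. F (t + p) = F t)"

definition regressive :: "real set \<Rightarrow> (real \<Rightarrow> 'a::real_normed_field^'n^'n) \<Rightarrow> bool" where
  "regressive T A \<longleftrightarrow> rd_continuous T A \<and>
     (\<forall>t\<in>T. invertible (mat 1 + graininess T t *\<^sub>R A t))"

definition solves_matrix_ivp ::
    "real set \<Rightarrow> (real \<Rightarrow> 'a::real_normed_field^'n^'n) \<Rightarrow> real \<Rightarrow> (real \<Rightarrow> 'a^'n^'n) \<Rightarrow> bool" where
  "solves_matrix_ivp T A \<tau> X \<longleftrightarrow>
     (\<forall>t\<in>T. has_delta_derivative T X (A t ** X t) t) \<and> X \<tau> = mat 1"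

text \<open>
  The solution is unique only on \<open>T\<close>, so the description picks its value at \<open>t\<close> rather than the
  solution as a function on the reals.
\<close>

definition transition_matrix ::
    "real set \<Rightarrow> (real \<Rightarrow> 'a::real_normed_field^'n^'n) \<Rightarrow> real \<Rightarrow> real \<Rightarrow> 'a^'n^'n" where
  "transition_matrix T A t \<tau> = (THE Y. \<exists>X. solves_matrix_ivp T A \<tau> X \<and> Y = X t)"

definition commutes_with_integral ::
    "real set \<Rightarrow> (real \<Rightarrow> 'a::real_normed_field^'n^'n) \<Rightarrow> bool" where
  "commutes_with_integral T R \<longleftrightarrow>
     (\<forall>s\<in>T. \<forall>t\<in>T. R t ** delta_integral T R s t = delta_integral T R s t ** R t)"

text \<open>
  \<open>e\<^sub>R\<close> is this notation for the transition matrix of an \<open>R\<close> that is regressive and commutes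
  with its integral; these two properties have to be stated wherever it is used.
\<close>

abbreviation (input) ts_exp ::
    "real set \<Rightarrow> (real \<Rightarrow> 'a::real_normed_field^'n^'n) \<Rightarrow> real \<Rightarrow> real \<Rightarrow> 'a^'n^'n" where
  "ts_exp T R t \<tau> \<equiv> transition_matrix T R t \<tau>"

text \<open>
  In the theorem, invertibility of \<open>R(t)\<close> as a matrix is asserted where \<open>\<mu>(t) < p\<close> or \<open>A(t)\<close> is
  invertible, and cannot hold elsewhere: if \<open>\<mu>(t) = p\<close>, then \<open>L(t + p) = L(t)\<close> gives
  \<open>I + p A(t) = L(t) (I + p R(t)) L(t)\<inverse>\<close>, so \<open>R(t)\<close> is similar to \<open>A(t)\<close>.
  For instance \<open>T = \<int>\<close>, \<open>p = 1\<close>, \<open>A = 0\<close> forces \<open>R = 0\<close>.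
\<close>

end

theory Submission
  imports Defs "HOL-Computational_Algebra.Computational_Algebra"
    "HOL-Computational_Algebra.Field_as_Ring"
begin

text \<open>
  A fundamental solution \<open>X\<close> of \<open>X\<^sup>\<Delta> = A X\<close> on a \<open>p\<close>-periodic time scale satisfies
  \<open>X(t + p) = X(t) C\<close> with a constant invertible matrix \<open>C\<close>. Embed \<open>C\<close> into a one-parameter
  group \<open>E\<close> of complex matrices with \<open>E(1) = C\<close> and generator \<open>W = E'(0)\<close>, and put
  \<open>R(t) = (E(\<mu>(t)/p) - I) / \<mu>(t)\<close>, read as \<open>W / p\<close> where \<open>\<mu>(t) = 0\<close>. Then
  \<open>e\<^sub>R(t, \<tau>) = E((t - \<tau>)/p)\<close>, and \<open>L(t) = X(t) E(-t/p)\<close> is \<open>p\<close>-periodic.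

  The eigenvalues of \<open>E(s)\<close> are \<open>exp (s w)\<close> with \<open>exp w\<close> an eigenvalue of \<open>C\<close>. Choosing
  \<open>0 < Im w \<le> 2\<pi>\<close> makes \<open>E(s) - I\<close> invertible for \<open>0 < s < 1\<close>, hence \<open>W\<close> and every \<open>R(t)\<close> with
  \<open>\<mu>(t) < p\<close> invertible. If \<open>\<mu>(t) = p\<close>, then \<open>C = X(t)\<inverse> (I + p A(t)) X(t)\<close>, so \<open>R(t)\<close> is similar
  to \<open>A(t)\<close>.
\<close>

section \<open>Delta derivatives\<close>

text \<open>Two existence questions carry the work. A periodic time scale is only required to be
  closed under \<open>t + p\<close>, so it has no maximum, but it may have a minimum or extend to
  minus infinity. Initial value problems are therefore solved upwards only, by Picard iteration from
  a least point, and the solutions on the pieces \<open>T \<inter> {a..}\<close> are glued. Delta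
  integrals become ordinary integrals of the function extended as a constant across each gap. The
  inverse of a fundamental solution is carried along as the solution of its own equation;
  regressivity makes that equation solvable upwards. The group \<open>E\<close> is built without
  normal forms. Some nonzero polynomial annihilates \<open>C\<close>, and modulo a factor
  \<open>(x - z)^K\<close> the power \<open>x^s\<close> is the truncated binomial series of
  \<open>z^s (1 + (x/z - 1))^s\<close>. Chinese remaindering merges these into one polynomial, whose
  value at \<open>C\<close> is \<open>E s\<close>, so that identities for \<open>E\<close> become
  polynomial congruences. This is where complex entries enter: a real invertible \<open>C\<close>
  need not have a real logarithm.\<close>

lemma fwd_jump_ge: "t \<le> fwd_jump T t"
  unfolding fwd_jump_def by (auto intro!: cInf_greatest)

lemma fwd_jump_le: "s \<in> T \<Longrightarrow> t < s \<Longrightarrow> fwd_jump T t \<le> s"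
  unfolding fwd_jump_def by (auto intro!: cInf_lower bdd_belowI[of _ t])

lemma fwd_jump_mem:
  assumes "closed T" "t \<in> T"
  shows "fwd_jump T t \<in> T"
proof (cases "\<exists>s\<in>T. t < s")
  case True
  have "Inf {s \<in> T. t < s} \<in> closure {s \<in> T. t < s}"
    using True by (intro closure_contains_Inf) (auto intro!: bdd_belowI[of _ t])
  also have "\<dots> \<subseteq> T"
    using assms(1) by (intro closure_minimal) auto
  finally show ?thesis using True by (simp add: fwd_jump_def)
qed (use assms in \<open>auto simp: fwd_jump_def\<close>)

lemma graininess_nonneg: "0 \<le> graininess T t"
  by (simp add: graininess_def fwd_jump_ge)

text \<open>If \<open>t\<close> is right-scattered, the factor
  \<open>\<bar>fwd_jump T t - s\<bar>\<close> stays away from \<open>0\<close> near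
  \<open>t\<close>, so the error bound only says that the error term vanishes at \<open>t\<close>
  and is continuous there. Later proofs split along these two cases instead of using the epsilon
  definition.\<close>

lemma has_delta_derivative_iff:
  fixes F :: "real \<Rightarrow> 'a::real_normed_vector"
  assumes "t \<in> T"
  shows "has_delta_derivative T F d t \<longleftrightarrow>
    (if fwd_jump T t = t then (F has_vector_derivative d) (at t within T)
     else continuous (at t within T) F \<and>
       F (fwd_jump T t) = F t + graininess T t *\<^sub>R d)"
proof (cases "fwd_jump T t = t")
  case True
  have "norm (F t - F s - (t - s) *\<^sub>R d) = norm (F s - F t - (s - t) *\<^sub>R d)" for s
    by (subst norm_minus_cancel[symmetric]) (simp add: algebra_simps)
  then show ?thesis
    using True by (simp add: has_delta_derivative_def has_vector_derivative_def
        has_derivative_within_alt bounded_linear_scaleR_left abs_minus_commute)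
next
  case False
  define \<sigma> where "\<sigma> = fwd_jump T t"
  have \<sigma>: "t < \<sigma>" using False fwd_jump_ge[of t T] by (simp add: \<sigma>_def)
  \<comment> \<open>The error term differs from \<open>-F\<close> by an affine function, so both are
    continuous at the same points.\<close>
  define G where "G s = F \<sigma> - F s - (\<sigma> - s) *\<^sub>R d" for s
  have F: "F = (\<lambda>s. F \<sigma> - (\<sigma> - s) *\<^sub>R d - G s)"
    by (simp add: G_def)
  have Gt: "F \<sigma> = F t + graininess T t *\<^sub>R d \<longleftrightarrow> G t = 0"
    by (auto simp: G_def graininess_def \<sigma>_def algebra_simps)
  have FG: "continuous (at t within T) F \<longleftrightarrow> continuous (at t within T) G"
  proof
    assume "continuous (at t within T) F"
    then show "continuous (at t within T) G"
      unfolding G_def by (intro continuous_intros)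
  next
    assume "continuous (at t within T) G"
    then show "continuous (at t within T) F"
      by (subst F) (intro continuous_intros)
  qed
  have "has_delta_derivative T F d t \<longleftrightarrow> continuous (at t within T) G \<and> G t = 0"
  proof
    assume H: "has_delta_derivative T F d t"
    have H': "\<exists>\<delta>>0. \<forall>s\<in>T. \<bar>s - t\<bar> < \<delta> \<longrightarrow> norm (G s) \<le> e * \<bar>\<sigma> - s\<bar>" if "e > 0" for e
      using H that unfolding has_delta_derivative_def G_def \<sigma>_def by blast
    have "norm (G t) \<le> 0"
    proof (rule field_le_epsilon)
      fix e :: real assume "e > 0"
      then have "e / (\<sigma> - t) > 0" using \<sigma> by simp
      from H'[OF this] obtain \<delta> where "\<delta> > 0" "\<forall>s\<in>T. \<bar>s - t\<bar> < \<delta> \<longrightarrow> norm (G s) \<le> e / (\<sigma> - t) * \<bar>\<sigma> - s\<bar>"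
        by blast
      then have "norm (G t) \<le> e / (\<sigma> - t) * \<bar>\<sigma> - t\<bar>" using assms by auto
      then show "norm (G t) \<le> 0 + e" using \<sigma> by simp
    qed
    then have G0: "G t = 0" by simp
    moreover have "continuous (at t within T) G"
      unfolding continuous_within_eps_delta
    proof (intro allI impI)
      fix e :: real assume "e > 0"
      \<comment> \<open>Within distance \<open>1\<close> of \<open>t\<close> the factor
        \<open>\<bar>\<sigma> - s\<bar>\<close> is at most \<open>\<sigma> - t + 1\<close>; the
        larger denominator makes the final inequality strict.\<close>
      then have "e / (\<sigma> - t + 2) > 0" using \<sigma> by simp
      from H'[OF this] obtain \<delta> where \<delta>: "\<delta> > 0" "\<forall>s\<in>T. \<bar>s - t\<bar> < \<delta> \<longrightarrow> norm (G s) \<le> e / (\<sigma> - t + 2) * \<bar>\<sigma> - s\<bar>"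
        by blast
      have "dist (G s) (G t) < e" if "s \<in> T" "dist s t < min 1 \<delta>" for s
      proof -
        have "norm (G s) \<le> e / (\<sigma> - t + 2) * \<bar>\<sigma> - s\<bar>" using that \<delta> by (auto simp: dist_real_def)
        also have "\<dots> \<le> e / (\<sigma> - t + 2) * (\<sigma> - t + 1)"
          using that \<sigma> \<open>e > 0\<close> by (intro mult_left_mono) (auto simp: dist_real_def)
        also have "\<dots> < e" using \<open>e > 0\<close> \<sigma> by (simp add: field_simps)
        finally show ?thesis by (simp add: G0)
      qed
      then show "\<exists>\<delta>>0. \<forall>s\<in>T. dist s t < \<delta> \<longrightarrow> dist (G s) (G t) < e"
        using \<delta>(1) by (intro exI[of _ "min 1 \<delta>"]) auto
    qed
    ultimately show "continuous (at t within T) G \<and> G t = 0" by simp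
  next
    assume G: "continuous (at t within T) G \<and> G t = 0"
    show "has_delta_derivative T F d t"
      unfolding has_delta_derivative_def
    proof (intro allI impI)
      fix e :: real assume "e > 0"
      \<comment> \<open>Points closer to \<open>t\<close> than half the gap keep distance at least
        \<open>(\<sigma> - t) / 2\<close> from \<open>\<sigma>\<close>, so this bound on
        \<open>G\<close> suffices.\<close>
      then have "e * (\<sigma> - t) / 2 > 0" using \<sigma> by simp
      with G obtain \<delta> where \<delta>: "\<delta> > 0" "\<And>s. s \<in> T \<Longrightarrow> dist s t < \<delta> \<Longrightarrow> norm (G s) < e * (\<sigma> - t) / 2"
        unfolding continuous_within_eps_delta by (metis dist_0_norm dist_commute)
      have "norm (G s) \<le> e * \<bar>\<sigma> - s\<bar>" if "s \<in> T" "\<bar>s - t\<bar> < min \<delta> ((\<sigma> - t) / 2)" for s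
      proof -
        have "norm (G s) \<le> e * ((\<sigma> - t) / 2)" using \<delta>(2)[of s] that by (auto simp: dist_real_def)
        moreover have "(\<sigma> - t) / 2 \<le> \<bar>\<sigma> - s\<bar>"
        proof -
          have "s - t < (\<sigma> - t) / 2" using that(2) abs_ge_self[of "s - t"] by simp
          then have "(\<sigma> - t) / 2 \<le> \<sigma> - s" by (simp add: field_simps)
          then show ?thesis using abs_ge_self[of "\<sigma> - s"] by linarith
        qed
        then have "e * ((\<sigma> - t) / 2) \<le> e * \<bar>\<sigma> - s\<bar>" using \<open>e > 0\<close>
          by (intro mult_left_mono) auto
        ultimately show ?thesis by linarith
      qed
      then show "\<exists>\<delta>>0. \<forall>s\<in>T. \<bar>s - t\<bar> < \<delta> \<longrightarrow>
        norm (F (fwd_jump T t) - F s - (fwd_jump T t - s) *\<^sub>R d) \<le> e * \<bar>fwd_jump T t - s\<bar>"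
        using \<delta>(1) \<sigma> unfolding G_def \<sigma>_def
        by (intro exI[of _ "min \<delta> ((fwd_jump T t - t) / 2)"]) (auto simp: \<sigma>_def)
    qed
  qed
  then show ?thesis using False FG Gt by (auto simp: \<sigma>_def)
qed

lemma has_delta_derivative_continuous:
  assumes "t \<in> T" "has_delta_derivative T F d t"
  shows "continuous (at t within T) F"
  using assms has_vector_derivative_continuous[of F d t T]
  by (auto simp: has_delta_derivative_iff split: if_splits)

lemma has_delta_derivative_fwd_jump:
  assumes "t \<in> T" "has_delta_derivative T F d t"
  shows "F (fwd_jump T t) = F t + graininess T t *\<^sub>R d"
  using assms by (auto simp: has_delta_derivative_iff graininess_def split: if_splits)

lemma has_delta_derivative_continuous_on:
  assumes "\<And>t. t \<in> T \<Longrightarrow> has_delta_derivative T F (d t) t"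
  shows "continuous_on T F"
  using assms has_delta_derivative_continuous by (metis continuous_on_eq_continuous_within)

lemma (in bounded_linear) has_delta_derivative:
  assumes "t \<in> T" "has_delta_derivative T g d t"
  shows "has_delta_derivative T (\<lambda>s. f (g s)) (f d) t"
  using assms by (auto simp: has_delta_derivative_iff add scaleR continuous
      intro: has_vector_derivative split: if_splits)

text \<open>Of the two forms of the product rule, this one evaluates the left factor at the forward
  jump. It matches the term \<open>Z (fwd_jump T t)\<close> in the equation of the inverse solution,
  where everything cancels.\<close>

lemma (in bounded_bilinear) has_delta_derivative:
  assumes t: "t \<in> T" and f: "has_delta_derivative T f f' t" and g: "has_delta_derivative T g g' t"
  shows "has_delta_derivative T (\<lambda>s. prod (f s) (g s))
    (prod f' (g t) + prod (f (fwd_jump T t)) g') t"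
proof (cases "fwd_jump T t = t")
  case True
  then show ?thesis
    using assms has_vector_derivative[of f f' t T g g']
    by (simp add: has_delta_derivative_iff add.commute)
next
  case False
  with assms show ?thesis
    by (auto simp: has_delta_derivative_iff add_left add_right scaleR_left scaleR_right
        algebra_simps intro!: continuous)
qed

lemma has_delta_derivative_transform:
  assumes "t \<in> T" "closed T" "\<And>s. s \<in> T \<Longrightarrow> f s = g s" "has_delta_derivative T f d t"
  shows "has_delta_derivative T g d t"
proof -
  have "fwd_jump T t \<in> T" using assms fwd_jump_mem by blast
  with assms(3,4) show ?thesis unfolding has_delta_derivative_def by auto
qed

text \<open>An induction along \<open>T\<close>: the infimum \<open>m\<close> of the points
  violating the bound would lie in \<open>T\<close>, satisfy the bound itself and be its own forward
  jump. The zero derivative then extends the bound slightly beyond \<open>m\<close>, against the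
  choice of \<open>m\<close>.\<close>

lemma delta_derivative_zero_bound:
  fixes F :: "real \<Rightarrow> 'a::real_normed_vector"
  assumes T: "closed T" and D: "\<And>t. t \<in> T \<Longrightarrow> has_delta_derivative T F 0 t"
    and a: "a \<in> T" "b \<in> T" "a \<le> b" and e: "e > 0"
  shows "norm (F b - F a) \<le> e * (b - a)"
proof (rule ccontr)
  assume nb: "\<not> norm (F b - F a) \<le> e * (b - a)"
  define bad where "bad = {r \<in> T. a \<le> r \<and> \<not> norm (F r - F a) \<le> e * (r - a)}"
  define m where "m = Inf bad"
  have "b \<in> bad" using nb a by (simp add: bad_def)
  have bdd: "bdd_below bad" by (auto simp: bad_def intro!: bdd_belowI[of _ a])
  have "m \<in> closure bad" unfolding m_def using \<open>b \<in> bad\<close> bdd by (intro closure_contains_Inf) auto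
  also have "closure bad \<subseteq> T \<inter> {a..}"
    using T by (intro closure_minimal) (auto simp: bad_def)
  finally have m: "m \<in> T" "a \<le> m" by auto
  have good: "norm (F r - F a) \<le> e * (r - a)" if "r \<in> T" "a \<le> r" "r < m" for r
  proof (rule ccontr)
    assume "\<not> ?thesis"
    then have "r \<in> bad" using that by (simp add: bad_def)
    then have "m \<le> r" unfolding m_def using bdd by (intro cInf_lower)
    with that show False by simp
  qed
  have cont: "continuous_on T F" using D by (rule has_delta_derivative_continuous_on)
  \<comment> \<open>With \<open>l\<close> the supremum of the points of \<open>T\<close> in
    \<open>{a..<m}\<close>, either \<open>l = m\<close> and the bound passes to the limit, or
    \<open>m\<close> is the forward jump of \<open>l\<close> and \<open>F\<close> does not change
    across the gap.\<close>
  have mgood: "norm (F m - F a) \<le> e * (m - a)"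
  proof (cases "a < m")
    case False
    then show ?thesis using m by simp
  next
    case am: True
    define S where "S = T \<inter> {a..<m}"
    have "a \<in> S" using a am by (simp add: S_def)
    have bddS: "bdd_above S" by (auto simp: S_def intro!: bdd_aboveI[of _ m])
    define l where "l = Sup S"
    have lcl: "l \<in> closure S" unfolding l_def using \<open>a \<in> S\<close> bddS by (intro closure_contains_Sup) auto
    moreover have "closure S \<subseteq> T \<inter> {a..m}"
      using T by (intro closure_minimal) (auto simp: S_def)
    ultimately have l: "l \<in> T" "a \<le> l" "l \<le> m" by auto
    have lgood: "norm (F l - F a) \<le> e * (l - a)"
    proof -
      have "closed {r \<in> T. norm (F r - F a) - e * (r - a) \<le> 0}"
        using T cont by (intro continuous_on_closed_Collect_le continuous_intros) auto
      then have "closure S \<subseteq> {r \<in> T. norm (F r - F a) - e * (r - a) \<le> 0}"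
        using good by (intro closure_minimal) (auto simp: S_def)
      then show ?thesis using lcl by auto
    qed
    show ?thesis
    proof (cases "l = m")
      case False
      then have "l < m" using l by simp
      have "fwd_jump T l = m"
      proof (rule antisym)
        show "fwd_jump T l \<le> m" using m \<open>l < m\<close> by (intro fwd_jump_le)
        have "m \<le> s" if "s \<in> T" "l < s" for s
        proof (rule ccontr)
          assume "\<not> m \<le> s"
          then have "s \<in> S" using that l by (auto simp: S_def)
          then have "s \<le> l" unfolding l_def using bddS by (intro cSup_upper)
          with that show False by simp
        qed
        then show "m \<le> fwd_jump T l" unfolding fwd_jump_def using m \<open>l < m\<close>
          by (auto intro!: cInf_greatest)
      qed
      then have "F m = F l" using has_delta_derivative_fwd_jump[OF l(1) D[OF l(1)]] by simp
      moreover have "e * (l - a) \<le> e * (m - a)" using e l by (intro mult_left_mono) auto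
      ultimately show ?thesis using lgood by simp
    qed (use lgood in simp)
  qed
  \<comment> \<open>Otherwise all violating points, being different from \<open>m\<close>, lie at or
    beyond the forward jump, which then is a larger lower bound than \<open>m\<close>.\<close>
  have sm: "fwd_jump T m = m"
  proof (rule ccontr)
    assume "fwd_jump T m \<noteq> m"
    then have "m < fwd_jump T m" using fwd_jump_ge[of m T] by simp
    have "F (fwd_jump T m) = F m" using has_delta_derivative_fwd_jump[OF m(1) D[OF m(1)]] by simp
    have "fwd_jump T m \<le> r" if "r \<in> bad" for r
    proof -
      have "r \<noteq> m" using that mgood by (auto simp: bad_def)
      moreover have "m \<le> r" unfolding m_def using bdd that by (intro cInf_lower)
      ultimately show ?thesis using that by (intro fwd_jump_le) (auto simp: bad_def)
    qed
    then have "fwd_jump T m \<le> m" unfolding m_def using \<open>b \<in> bad\<close>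
      by (intro cInf_greatest) auto
    with \<open>m < fwd_jump T m\<close> show False by simp
  qed
  obtain \<delta> where \<delta>: "\<delta> > 0" "\<And>s. s \<in> T \<Longrightarrow> \<bar>s - m\<bar> < \<delta> \<Longrightarrow> norm (F m - F s) \<le> e * \<bar>m - s\<bar>"
    using D[OF m(1)] e sm unfolding has_delta_derivative_def by auto
  have "\<exists>r\<in>bad. r < m + \<delta>"
    using cInf_lessD[of bad "m + \<delta>"] \<open>b \<in> bad\<close> \<delta>(1) by (auto simp: m_def)
  then obtain r where r: "r \<in> bad" "r < m + \<delta>" by blast
  have "m \<le> r" unfolding m_def using bdd r by (intro cInf_lower)
  have "norm (F r - F a) \<le> norm (F m - F r) + norm (F m - F a)"
    using norm_triangle_ineq4[of "F m - F a" "F m - F r"] by simp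
  then have "norm (F r - F a) \<le> e * (r - m) + e * (m - a)"
    using \<delta>(2)[of r] r \<open>m \<le> r\<close> mgood by (force simp: bad_def)
  also have "\<dots> = e * (r - a)" by (simp add: algebra_simps)
  finally show False using r by (simp add: bad_def)
qed

lemma delta_derivative_zero_imp_const:
  fixes F :: "real \<Rightarrow> 'a::real_normed_vector"
  assumes T: "closed T" and D: "\<And>t. t \<in> T \<Longrightarrow> has_delta_derivative T F 0 t"
    and "a \<in> T" "b \<in> T"
  shows "F a = F b"
  using assms(3,4)
proof (induction a b rule: linorder_wlog)
  case (le a b)
  have "norm (F b - F a) \<le> 0"
  proof (rule field_le_epsilon)
    fix e :: real assume "e > 0"
    have "norm (F b - F a) \<le> e / (b - a + 1) * (b - a)"
      using le \<open>e > 0\<close> by (intro delta_derivative_zero_bound[OF T D]) auto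
    also have "\<dots> \<le> e" using le \<open>e > 0\<close> by (simp add: field_simps)
    finally show "norm (F b - F a) \<le> 0 + e" by simp
  qed
  then show ?case by simp
qed simp

section \<open>Antiderivatives and linear initial value problems\<close>

definition regulated :: "(real \<Rightarrow> 'a::topological_space) \<Rightarrow> bool" where
  "regulated f \<longleftrightarrow> (\<forall>x. (\<exists>l. (f \<longlongrightarrow> l) (at_left x)) \<and> (\<exists>r. (f \<longlongrightarrow> r) (at_right x)))"

lemma regulated_local_approx:
  fixes f :: "real \<Rightarrow> 'a::real_normed_vector"
  assumes "regulated f" "e > 0"
  obtains l r d where "d > 0" "\<And>y. x - d < y \<Longrightarrow> y < x \<Longrightarrow> norm (f y - l) < e"
    "\<And>y. x < y \<Longrightarrow> y < x + d \<Longrightarrow> norm (f y - r) < e"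
proof -
  obtain l r where l: "(f \<longlongrightarrow> l) (at_left x)" and r: "(f \<longlongrightarrow> r) (at_right x)"
    using assms(1) unfolding regulated_def by blast
  have "\<forall>\<^sub>F y in at_left x. norm (f y - l) < e"
    using tendstoD[OF l assms(2)] by (simp add: dist_norm)
  then obtain d1 where d1: "d1 < x" "\<And>y. d1 < y \<Longrightarrow> y < x \<Longrightarrow> norm (f y - l) < e"
    using eventually_at_left_real[of "x - 1" x] unfolding eventually_at_left_field by auto
  have "\<forall>\<^sub>F y in at_right x. norm (f y - r) < e"
    using tendstoD[OF r assms(2)] by (simp add: dist_norm)
  then obtain d2 where d2: "x < d2" "\<And>y. x < y \<Longrightarrow> y < d2 \<Longrightarrow> norm (f y - r) < e"
    unfolding eventually_at_right_field by auto
  show thesis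
    by (rule that[of "min (x - d1) (d2 - x)" l r]) (use d1 d2 in auto)
qed

text \<open>Around each tag the function is uniformly close to one that is constant on either side
  of the tag. A fine tagged division turns this into a uniform approximation by integrable
  functions.\<close>

lemma regulated_integrable:
  fixes f :: "real \<Rightarrow> 'a::banach"
  assumes "regulated f"
  shows "f integrable_on {a..b}"
proof -
  have "\<exists>g. (\<forall>x\<in>cbox a b. norm (f x - g x) \<le> e) \<and> g integrable_on cbox a b" if e: "e > 0" for e
  proof -
    have "\<exists>d l r. d > 0 \<and> (\<forall>y. x - d < y \<longrightarrow> y < x \<longrightarrow> norm (f y - l) < e) \<and>
        (\<forall>y. x < y \<longrightarrow> y < x + d \<longrightarrow> norm (f y - r) < e)" for x
      using regulated_local_approx[OF assms e, of x] by metis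
    then obtain d l r where d: "\<And>x. d x > 0"
      and l: "\<And>x y. x - d x < y \<Longrightarrow> y < x \<Longrightarrow> norm (f y - l x) < e"
      and r: "\<And>x y. x < y \<Longrightarrow> y < x + d x \<Longrightarrow> norm (f y - r x) < e"
      by metis
    have "gauge (\<lambda>x. ball x (d x))" using d by (rule gauge_ball_dependent[rule_format])
    then obtain p where p: "p tagged_division_of (cbox a b)" "(\<lambda>x. ball x (d x)) fine p"
      by (rule fine_division_exists)
    have "\<exists>g. (\<forall>x\<in>k. norm (f x - g x) \<le> e) \<and> g integrable_on k" if k: "k \<in> snd ` p" for k
    proof -
      obtain x where x: "(x, k) \<in> p" using k by auto
      then obtain u v where uv: "k = cbox u v" "x \<in> k"
        using p(1) by (metis tagged_division_ofD(2,4))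
      have sub: "k \<subseteq> ball x (d x)" using p(2) x by (auto simp: fine_def)
      \<comment> \<open>The value at the tag is kept, because one-sided limits say nothing about
        \<open>f x\<close>.\<close>
      define g where "g y = (if y < x then l x else if x < y then r x else f x)" for y
      have "norm (f y - g y) \<le> e" if "y \<in> k" for y
      proof -
        have "dist x y < d x" using that sub by auto
        then show ?thesis using l[of x y] r[of x y] e by (auto simp: g_def dist_real_def)
      qed
      moreover have "g integrable_on k"
      proof -
        have "g integrable_on {u..x}"
          by (rule integrable_spike_finite[where S = "{x}" and f = "\<lambda>_. l x"])
             (auto simp: g_def)
        moreover have "g integrable_on {x..v}"
          by (rule integrable_spike_finite[where S = "{x}" and f = "\<lambda>_. r x"])
             (auto simp: g_def)
        ultimately show ?thesis
          using uv by (auto intro!: Henstock_Kurzweil_Integration.integrable_combine[of u x v])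
      qed
      ultimately show ?thesis by blast
    qed
    with approximable_on_division[OF _ division_of_tagged_division[OF p(1)], of e f] e
    show ?thesis by (metis less_imp_le)
  qed
  then show ?thesis using integrable_uniform_limit[of a b f] by (simp add: box_real)
qed

text \<open>The one-sided limits give local bounds, and a fine division serves as the finite
  subcover of the interval. Summing the local bounds avoids a maximum.\<close>

lemma regulated_bounded:
  fixes f :: "real \<Rightarrow> 'a::real_normed_vector"
  assumes "regulated f"
  obtains B where "B > 0" "\<And>x. x \<in> {a..b} \<Longrightarrow> norm (f x) \<le> B"
proof -
  have "\<exists>d B. d > 0 \<and> (\<forall>y. \<bar>y - x\<bar> < d \<longrightarrow> norm (f y) \<le> B)" for x
  proof -
    obtain l r d where d: "d > 0" "\<And>y. x - d < y \<Longrightarrow> y < x \<Longrightarrow> norm (f y - l) < 1"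
      "\<And>y. x < y \<Longrightarrow> y < x + d \<Longrightarrow> norm (f y - r) < 1"
      using regulated_local_approx[OF assms zero_less_one, of x] by metis
    have "norm (f y) \<le> norm (f x) + norm l + norm r + 1" if "\<bar>y - x\<bar> < d" for y
    proof -
      consider "y = x" | "y < x" | "x < y" by linarith
      then show ?thesis
      proof cases
        case 2
        then have "norm (f y - l) < 1" using d(2)[of y] that by auto
        then show ?thesis using norm_triangle_sub[of "f y" l] norm_ge_zero[of r] norm_ge_zero[of "f x"] by linarith
      next
        case 3
        then have "norm (f y - r) < 1" using d(3)[of y] that by auto
        then show ?thesis using norm_triangle_sub[of "f y" r] norm_ge_zero[of l] norm_ge_zero[of "f x"] by linarith
      qed (auto intro: add_nonneg_nonneg)
    qed
    then show ?thesis using d(1) by blast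
  qed
  then obtain d B where d: "\<And>x. d x > 0" "\<And>x y. \<bar>y - x\<bar> < d x \<Longrightarrow> norm (f y) \<le> B x"
    by metis
  have "gauge (\<lambda>x. ball x (d x))" using d(1) by (rule gauge_ball_dependent[rule_format])
  then obtain p where p: "p tagged_division_of (cbox a b)" "(\<lambda>x. ball x (d x)) fine p"
    by (rule fine_division_exists)
  have fin: "finite p" using p(1) by auto
  define C where "C = 1 + (\<Sum>q\<in>p. \<bar>B (fst q)\<bar>)"
  have C: "C > 0" unfolding C_def by (intro add_pos_nonneg sum_nonneg) auto
  have "norm (f x) \<le> C" if x: "x \<in> {a..b}" for x
  proof -
    have "x \<in> \<Union>{k. \<exists>y. (y, k) \<in> p}" using tagged_division_ofD(6)[OF p(1)] x by simp
    then obtain y k where yk: "(y, k) \<in> p" "x \<in> k" by blast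
    then have "x \<in> ball y (d y)" using p(2) by (fastforce simp: fine_def)
    then have "norm (f x) \<le> B y" by (intro d(2)) (auto simp: dist_real_def abs_minus_commute)
    also have "B y \<le> (\<Sum>q\<in>p. \<bar>B (fst q)\<bar>)"
      using member_le_sum[OF yk(1), of "\<lambda>q. \<bar>B (fst q)\<bar>"] fin by auto
    finally show ?thesis by (simp add: C_def)
  qed
  with C that show thesis by blast
qed

text \<open>The primitive is anchored at \<open>0\<close> and extended to both sides, so that it
  lives on the whole line even when the time scale has no least point to integrate from.\<close>

lemma regulated_primitive:
  fixes g :: "real \<Rightarrow> 'a::banach"
  assumes "regulated g"
  obtains G where "\<And>s t. s \<le> t \<Longrightarrow> (g has_integral (G t - G s)) {s..t}" "continuous_on UNIV G"
proof -
  define G where "G t = (if 0 \<le> t then integral {0..t} g else - integral {t..0} g)" for t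
  note int = regulated_integrable[OF assms]
  note comb = Henstock_Kurzweil_Integration.integral_combine[OF _ _ int]
  have G: "G t - G s = integral {s..t} g" if "s \<le> t" for s t
  proof -
    consider "0 \<le> s" | "s < 0" "0 \<le> t" | "t < 0" by linarith
    then show ?thesis
    proof cases
      case 1 then show ?thesis using comb[of 0 s t] that by (simp add: G_def algebra_simps)
    next
      case 2 then show ?thesis using comb[of s 0 t] that by (simp add: G_def algebra_simps)
    next
      case 3 then show ?thesis using comb[of s t 0] that by (simp add: G_def algebra_simps)
    qed
  qed
  have "isCont G x" for x
  proof -
    have "continuous_on {x - 1..x + 1} (\<lambda>t. G (x - 1) + integral {x - 1..t} g)"
      by (intro continuous_intros indefinite_integral_continuous_1 int)
    then have "continuous_on {x - 1..x + 1} G"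
    proof (rule continuous_on_eq)
      fix t assume "t \<in> {x - 1..x + 1}"
      then show "G (x - 1) + integral {x - 1..t} g = G t" using G[of "x - 1" t] by (simp add: algebra_simps)
    qed
    then have "continuous_on {x - 1<..<x + 1} G" by (rule continuous_on_subset) auto
    then show ?thesis by (simp add: continuous_on_eq_continuous_at)
  qed
  then have "continuous_on UNIV G" by (simp add: continuous_on_eq_continuous_at)
  moreover have "(g has_integral (G t - G s)) {s..t}" if "s \<le> t" for s t
    using G[OF that] int[of s t] by (simp add: integrable_integral)
  ultimately show thesis using that by blast
qed

text \<open>Composition with this map extends a function on \<open>T\<close> to the reals as a
  constant on each gap: a gap after \<open>t\<close> then contributes
  \<open>graininess T t *\<^sub>R f t\<close> to an ordinary integral, as the delta integral
  demands. Below all points of \<open>T\<close> the supremum is that of the empty set, a fixed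
  value.\<close>

definition last_point :: "real set \<Rightarrow> real \<Rightarrow> real" where
  "last_point T s = Sup {t \<in> T. t \<le> s}"

lemma last_point_upper: "t \<in> T \<Longrightarrow> t \<le> s \<Longrightarrow> t \<le> last_point T s"
  unfolding last_point_def by (auto intro!: cSup_upper bdd_aboveI[of _ s])

lemma last_point_mem:
  assumes "closed T" "t \<in> T" "t \<le> s"
  shows "last_point T s \<in> T" "last_point T s \<le> s"
proof -
  have "last_point T s \<in> closure {t \<in> T. t \<le> s}"
    unfolding last_point_def using assms
    by (intro closure_contains_Sup) (auto intro!: bdd_aboveI[of _ s])
  also have "\<dots> \<subseteq> T \<inter> {..s}"
    using assms(1) by (intro closure_minimal) auto
  finally show "last_point T s \<in> T" "last_point T s \<le> s" by auto
qed

lemma last_point_self: "closed T \<Longrightarrow> t \<in> T \<Longrightarrow> last_point T t = t"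
  using last_point_mem(2)[of T t t] last_point_upper[of t T t] by force

text \<open>On each side of \<open>x\<close>, either \<open>T\<close> has no points near
  \<open>x\<close> and the extension is locally constant, or \<open>T\<close> accumulates there.
  Then \<open>x\<close> is left-dense or right-dense and rd-continuity supplies the limit.\<close>

lemma regulated_comp_last_point:
  fixes f :: "real \<Rightarrow> 'a::metric_space"
  assumes T: "closed T" and f: "rd_continuous T f"
  shows "regulated (\<lambda>s. f (last_point T s))"
  unfolding regulated_def
proof (intro allI conjI)
  fix x
  show "\<exists>l. ((\<lambda>s. f (last_point T s)) \<longlongrightarrow> l) (at_left x)"
  proof (cases "\<exists>d<x. \<forall>t\<in>T. d < t \<longrightarrow> \<not> t < x")
    case True
    then obtain d where d: "d < x" "\<And>t. t \<in> T \<Longrightarrow> d < t \<Longrightarrow> \<not> t < x" by blast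
    have "last_point T s = last_point T d" if "d < s" "s < x" for s
    proof -
      have "{t \<in> T. t \<le> s} = {t \<in> T. t \<le> d}" using d that by force
      then show ?thesis by (simp add: last_point_def)
    qed
    then have "\<forall>\<^sub>F s in at_left x. f (last_point T s) = f (last_point T d)"
      using d(1) unfolding eventually_at_left_field by auto
    then show ?thesis by (blast intro: tendsto_eventually)
  next
    case False
    then have dense: "\<exists>t\<in>T. d < t \<and> t < x" if "d < x" for d using that by blast
    have "x \<in> closure T"
      unfolding closure_approachable
    proof (intro allI impI)
      fix e :: real assume "e > 0"
      then obtain y where "y \<in> T" "x - e < y" "y < x" using dense[of "x - e"] by auto
      then show "\<exists>y\<in>T. dist y x < e" by (intro bexI[of _ y]) (auto simp: dist_real_def)
    qed
    then have xT: "x \<in> T" using T by simp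
    have "left_dense T x"
      unfolding left_dense_def
    proof
      show ex: "\<exists>s\<in>T. s < x" using dense[of "x - 1"] by auto
      show "Sup {s \<in> T. s < x} = x"
      proof (rule cSup_eq_non_empty)
        show "{s \<in> T. s < x} \<noteq> {}" using ex by auto
        show "x \<le> y" if "\<And>z. z \<in> {s \<in> T. s < x} \<Longrightarrow> z \<le> y" for y
          using dense[of y] that by force
      qed auto
    qed
    then obtain l where l: "(f \<longlongrightarrow> l) (at x within (T \<inter> {..<x}))"
      using f xT by (auto simp: rd_continuous_def)
    have "((\<lambda>s. f (last_point T s)) \<longlongrightarrow> l) (at_left x)"
    proof (rule tendstoI)
      fix e :: real assume "e > 0"
      from tendstoD[OF l this] obtain d where d: "d > 0"
        "\<And>t. t \<in> T \<Longrightarrow> t < x \<Longrightarrow> dist t x < d \<Longrightarrow> dist (f t) l < e"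
        unfolding eventually_at by auto
      obtain t0 where t0: "t0 \<in> T" "x - d < t0" "t0 < x" using dense[of "x - d"] d(1) by auto
      have "dist (f (last_point T s)) l < e" if "t0 < s" "s < x" for s
        using last_point_mem[OF T t0(1), of s] last_point_upper[OF t0(1), of s] that t0
        by (intro d(2)) (auto simp: dist_real_def)
      then show "\<forall>\<^sub>F s in at_left x. dist (f (last_point T s)) l < e"
        using t0(3) unfolding eventually_at_left_field by auto
    qed
    then show ?thesis by blast
  qed
  show "\<exists>r. ((\<lambda>s. f (last_point T s)) \<longlongrightarrow> r) (at_right x)"
  proof (cases "\<exists>d>x. \<forall>t\<in>T. x < t \<longrightarrow> \<not> t < d")
    case True
    then obtain d where d: "x < d" "\<And>t. t \<in> T \<Longrightarrow> x < t \<Longrightarrow> \<not> t < d" by blast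
    have "last_point T s = last_point T x" if "x < s" "s < d" for s
    proof -
      have "{t \<in> T. t \<le> s} = {t \<in> T. t \<le> x}" using d that by force
      then show ?thesis by (simp add: last_point_def)
    qed
    then have "\<forall>\<^sub>F s in at_right x. f (last_point T s) = f (last_point T x)"
      using d(1) unfolding eventually_at_right_field by auto
    then show ?thesis by (blast intro: tendsto_eventually)
  next
    case False
    then have dense: "\<exists>t\<in>T. x < t \<and> t < d" if "x < d" for d using that by blast
    have "x \<in> closure T"
      unfolding closure_approachable
    proof (intro allI impI)
      fix e :: real assume "e > 0"
      then obtain y where "y \<in> T" "x < y" "y < x + e" using dense[of "x + e"] by auto
      then show "\<exists>y\<in>T. dist y x < e" by (intro bexI[of _ y]) (auto simp: dist_real_def)
    qed
    then have xT: "x \<in> T" using T by simp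
    have "fwd_jump T x \<le> x"
    proof (rule ccontr)
      assume "\<not> ?thesis"
      then obtain t where "t \<in> T" "x < t" "t < fwd_jump T x" using dense by force
      then show False using fwd_jump_le[of t T x] by simp
    qed
    then have "right_dense T x"
      unfolding right_dense_def using fwd_jump_ge[of x T] dense[of "x + 1"] by auto
    then have cont: "continuous (at x within T) f"
      using f xT by (auto simp: rd_continuous_def)
    have "((\<lambda>s. f (last_point T s)) \<longlongrightarrow> f x) (at_right x)"
    proof (rule tendstoI)
      fix e :: real assume "e > 0"
      with cont obtain d where d: "d > 0"
        "\<And>t. t \<in> T \<Longrightarrow> dist t x < d \<Longrightarrow> dist (f t) (f x) < e"
        unfolding continuous_within_eps_delta by blast
      have "dist (f (last_point T s)) (f x) < e" if "x < s" "s < x + d" for s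
        using last_point_mem[OF T xT, of s] last_point_upper[OF xT, of s] that
        by (intro d(2)) (auto simp: dist_real_def)
      then show "\<forall>\<^sub>F s in at_right x. dist (f (last_point T s)) (f x) < e"
        using d(1) unfolding eventually_at_right_field by (intro exI[of _ "x + d"]) auto
    qed
    then show ?thesis by blast
  qed
qed

text \<open>Across a gap the integrand is constant. At a point equal to its forward jump, the
  existence of a later point makes it right-dense, so \<open>f\<close> is continuous there and the
  integrand is close to \<open>f t\<close> nearby.\<close>

lemma has_delta_derivative_primitive:
  fixes f :: "real \<Rightarrow> 'a::banach"
  assumes T: "closed T" and f: "rd_continuous T f"
    and G: "\<And>s t. s \<le> t \<Longrightarrow> ((\<lambda>u. f (last_point T u)) has_integral (G t - G s)) {s..t}"
    and cont: "continuous_on UNIV G"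
    and t: "t \<in> T" "\<exists>s\<in>T. t < s"
  shows "has_delta_derivative T G (f t) t"
proof (cases "fwd_jump T t = t")
  case False
  then have less: "t < fwd_jump T t" using fwd_jump_ge[of t T] by simp
  have const: "f (last_point T u) = f t" if "u \<in> {t..fwd_jump T t} - {fwd_jump T t}" for u
  proof -
    have "last_point T u = last_point T t"
    proof -
      have "{s \<in> T. s \<le> u} = {s \<in> T. s \<le> t}" using that fwd_jump_le[of _ T t] by force
      then show ?thesis by (simp add: last_point_def)
    qed
    then show ?thesis using last_point_self[OF T t(1)] by simp
  qed
  \<comment> \<open>At the right end of the gap the extension already takes the next value; this
    single point is spiked out.\<close>
  have "((\<lambda>u. f (last_point T u)) has_integral (fwd_jump T t - t) *\<^sub>R f t) {t..fwd_jump T t}"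
    by (rule has_integral_spike_finite[where S = "{fwd_jump T t}" and f = "\<lambda>_. f t"])
       (use const has_integral_const_real[of "f t" t "fwd_jump T t"] less in auto)
  with G[of t "fwd_jump T t"] less
  have "G (fwd_jump T t) - G t = (fwd_jump T t - t) *\<^sub>R f t"
    by (intro has_integral_unique) auto
  moreover have "continuous (at t within T) G"
    using cont by (simp add: continuous_on_eq_continuous_at continuous_at_imp_continuous_at_within)
  ultimately show ?thesis
    using t False by (simp add: has_delta_derivative_iff graininess_def algebra_simps)
next
  case True
  \<comment> \<open>The start \<open>s\<close> belongs to \<open>T\<close>, so last points of
    arguments in \<open>{s..s'}\<close> stay in that interval and a bound on \<open>T\<close> alone
    controls the integral.\<close>
  have bound: "norm (G s' - G s - (s' - s) *\<^sub>R c) \<le> e * (s' - s)"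
    if "s \<in> T" "s \<le> s'" "\<And>r. r \<in> T \<Longrightarrow> s \<le> r \<Longrightarrow> r \<le> s' \<Longrightarrow> norm (f r - c) \<le> e" "e \<ge> 0" for s s' c e
  proof -
    have "((\<lambda>u. f (last_point T u) - c) has_integral (G s' - G s - (s' - s) *\<^sub>R c)) {s..s'}"
      using has_integral_diff[OF G[OF that(2)] has_integral_const_real[of c s s']] that(2) by simp
    moreover have "norm (f (last_point T u) - c) \<le> e" if "u \<in> {s..s'}" for u
      using last_point_mem[OF T \<open>s \<in> T\<close>, of u] last_point_upper[OF \<open>s \<in> T\<close>, of u] that
      by (intro \<open>\<And>r. r \<in> T \<Longrightarrow> s \<le> r \<Longrightarrow> r \<le> s' \<Longrightarrow> norm (f r - c) \<le> e\<close>) auto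
    ultimately show ?thesis
      using has_integral_bound_real[of e "{}" _ _ s s'] that(2,4) by auto
  qed
  have "right_dense T t" using True t by (simp add: right_dense_def)
  then have cont_f: "continuous (at t within T) f" using f t by (simp add: rd_continuous_def)
  have "\<exists>\<delta>>0. \<forall>s\<in>T. \<bar>s - t\<bar> < \<delta> \<longrightarrow> norm (G t - G s - (t - s) *\<^sub>R f t) \<le> e * \<bar>t - s\<bar>"
    if e: "e > 0" for e
  proof -
    from cont_f e obtain d where d: "d > 0"
      "\<And>r. r \<in> T \<Longrightarrow> dist r t < d \<Longrightarrow> dist (f r) (f t) < e"
      unfolding continuous_within_eps_delta by blast
    have "norm (G t - G s - (t - s) *\<^sub>R f t) \<le> e * \<bar>t - s\<bar>" if s: "s \<in> T" "\<bar>s - t\<bar> < d" for s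
    proof (cases "s \<le> t")
      case True
      have "norm (G t - G s - (t - s) *\<^sub>R f t) \<le> e * (t - s)"
      proof (rule bound[OF s(1) True])
        fix r assume "r \<in> T" "s \<le> r" "r \<le> t"
        then show "norm (f r - f t) \<le> e" using d(2)[of r] s by (simp add: dist_real_def dist_norm)
      qed (use e in simp)
      then show ?thesis using True by simp
    next
      case False
      have "norm (G s - G t - (s - t) *\<^sub>R f t) \<le> e * (s - t)"
      proof (rule bound[OF t(1)])
        fix r assume "r \<in> T" "t \<le> r" "r \<le> s"
        then show "norm (f r - f t) \<le> e" using d(2)[of r] s by (simp add: dist_real_def dist_norm)
      qed (use e False in simp_all)
      moreover have "G s - G t - (s - t) *\<^sub>R f t = - (G t - G s - (t - s) *\<^sub>R f t)"
        by (simp add: algebra_simps)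
      moreover have "\<bar>t - s\<bar> = s - t" using False by simp
      ultimately show ?thesis by (metis norm_minus_cancel)
    qed
    then show ?thesis using d(1) by blast
  qed
  then show ?thesis unfolding has_delta_derivative_def True by blast
qed

lemma rd_continuous_imp_antiderivative:
  fixes f :: "real \<Rightarrow> 'a::banach"
  assumes "closed T" "rd_continuous T f" "\<And>t. t \<in> T \<Longrightarrow> \<exists>s\<in>T. t < s"
  obtains F where "\<And>t. t \<in> T \<Longrightarrow> has_delta_derivative T F (f t) t"
proof -
  obtain G where "\<And>s t. s \<le> t \<Longrightarrow> ((\<lambda>u. f (last_point T u)) has_integral (G t - G s)) {s..t}"
    "continuous_on UNIV G"
    using regulated_primitive[OF regulated_comp_last_point[OF assms(1,2)]] by metis
  note G = this
  show thesis
    by (rule that[OF has_delta_derivative_primitive[OF assms(1,2) G _ assms(3)]])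
qed

lemma rd_continuous_continuous_on:
  "continuous_on T f \<Longrightarrow> rd_continuous T f"
  unfolding rd_continuous_def continuous_on_eq_continuous_within continuous_within
  by (blast intro: tendsto_within_subset)

lemma (in bounded_bilinear) rd_continuous:
  "rd_continuous T f \<Longrightarrow> rd_continuous T g \<Longrightarrow> rd_continuous T (\<lambda>t. prod (f t) (g t))"
  by (fastforce simp: rd_continuous_def intro: continuous tendsto)

lemma rd_continuous_diff:
  fixes f g :: "real \<Rightarrow> 'a::real_normed_vector"
  shows "rd_continuous T f \<Longrightarrow> rd_continuous T g \<Longrightarrow> rd_continuous T (\<lambda>t. f t - g t)"
  by (fastforce simp: rd_continuous_def intro: continuous_diff tendsto_diff)

text \<open>Picard iteration; the weight \<open>exp (2 C (t - a))\<close> makes each step a contraction by \<open>1/2\<close>.\<close>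

lemma linear_ivp_solution:
  fixes prod :: "'a::real_normed_vector \<Rightarrow> 'v::banach \<Rightarrow> 'v"
  assumes T: "closed T" "a \<in> T" "\<And>t. t \<in> T \<Longrightarrow> a \<le> t" and unb: "\<And>t. t \<in> T \<Longrightarrow> \<exists>s\<in>T. t < s"
    and prod: "bounded_bilinear prod" and A: "rd_continuous T A"
  obtains X where "X a = x0" "\<And>t. t \<in> T \<Longrightarrow> has_delta_derivative T X (prod (A t) (X t)) t"
proof -
  interpret bounded_bilinear prod by fact
  define P where "P h t = integral {a..t} (\<lambda>u. h (last_point T u))" for h :: "real \<Rightarrow> 'v" and t
  have last: "last_point T u \<in> T" "a \<le> last_point T u" "last_point T u \<le> u" if "a \<le> u" for u
    using last_point_mem[OF T(1,2) that] last_point_upper[OF T(2) that] by auto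
  have int: "(\<lambda>u. h (last_point T u)) integrable_on {s..t}" if "rd_continuous T h" for h :: "real \<Rightarrow> 'v" and s t
    using that T(1) by (intro regulated_integrable regulated_comp_last_point)
  have P_deriv: "has_delta_derivative T (P h) (h t) t" if h: "rd_continuous T h" and t: "t \<in> T" for h t
  proof -
    obtain G where G: "\<And>s t. s \<le> t \<Longrightarrow> ((\<lambda>u. h (last_point T u)) has_integral (G t - G s)) {s..t}"
      "continuous_on UNIV G"
      using regulated_primitive[OF regulated_comp_last_point[OF T(1) h]] by metis
    have "P h r = G r - G a" if "r \<in> T" for r
      using G(1)[of a r] T(3)[OF that] by (simp add: P_def integral_unique)
    moreover have "has_delta_derivative T (\<lambda>r. G r - G a) (h t) t"
      using has_delta_derivative_primitive[OF T(1) h G t unb[OF t]]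
      by (simp add: has_delta_derivative_def)
    ultimately show ?thesis
      using has_delta_derivative_transform[OF t T(1), of "\<lambda>r. G r - G a" "P h"] by simp
  qed
  have P_cont: "continuous_on T (P h)" if "rd_continuous T h" for h
    using P_deriv[OF that] by (rule has_delta_derivative_continuous_on)
  have AX: "rd_continuous T (\<lambda>t. prod (A t) (X t))" if "continuous_on T X" for X
    using A rd_continuous_continuous_on[OF that] by (rule rd_continuous)
  \<comment> \<open>These are the increments of the Picard iteration, not the iterates; the solution
    is their sum.\<close>
  define D where "D n = ((\<lambda>X. P (\<lambda>t. prod (A t) (X t))) ^^ n) (\<lambda>_. x0)" for n
  have D_0: "D 0 = (\<lambda>_. x0)" and D_Suc: "D (Suc n) = P (\<lambda>t. prod (A t) (D n t))" for n
    by (simp_all add: D_def)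
  have D_cont: "continuous_on T (D n)" for n
    by (induction n) (auto simp: D_0 D_Suc intro!: P_cont AX)
  \<comment> \<open>The coefficient is bounded only on bounded parts of \<open>T\<close>, so
    convergence below is uniform on each \<open>T \<inter> {..b}\<close> and not on
    \<open>T\<close>.\<close>
  have bound: "\<exists>C>0. \<forall>t\<in>T. t \<le> b \<longrightarrow> (\<forall>x. norm (prod (A t) x) \<le> C * norm x)" for b
  proof -
    obtain B where B: "B > 0" "\<And>u. u \<in> {a..b} \<Longrightarrow> norm (A (last_point T u)) \<le> B"
      using regulated_bounded[OF regulated_comp_last_point[OF T(1) A]] by metis
    obtain K where K: "K > 0" "\<And>x y. norm (prod x y) \<le> norm x * norm y * K"
      using pos_bounded by blast
    have "norm (prod (A t) x) \<le> (B * K) * norm x" if "t \<in> T" "t \<le> b" for t x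
    proof -
      have "norm (A t) \<le> B" using B(2)[of t] that T(3) last_point_self[OF T(1) that(1)] by simp
      then have "norm (A t) * norm x * K \<le> B * norm x * K"
        using K(1) by (intro mult_right_mono) auto
      then show ?thesis using K(2)[of "A t" x] by (simp add: algebra_simps)
    qed
    then show ?thesis using B(1) K(1) by (intro exI[of _ "B * K"]) auto
  qed
  have D_bound: "norm (D n t) \<le> norm x0 * (1/2) ^ n * exp (2 * C * (t - a))"
    if C: "C > 0" "\<And>t x. t \<in> T \<Longrightarrow> t \<le> b \<Longrightarrow> norm (prod (A t) x) \<le> C * norm x"
      and t: "t \<in> T" "t \<le> b" for n t b C
    using t
  proof (induction n arbitrary: t)
    case 0
    have "norm x0 * 1 \<le> norm x0 * exp (2 * C * (t - a))"
      using T(3)[OF 0(1)] C(1) by (intro mult_left_mono) auto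
    then show ?case by (simp add: D_0)
  next
    case (Suc n)
    define K where "K = norm x0 * (1/2) ^ n"
    have K: "K \<ge> 0" by (simp add: K_def)
    have at: "a \<le> t" using T(3) Suc by auto
    \<comment> \<open>The coefficient contributes \<open>C\<close> and integrating the weight
      contributes \<open>1 / (2 * C)\<close>; their product is the factor
      \<open>1/2\<close>.\<close>
    have "((\<lambda>u. C * K * exp (2 * C * (u - a))) has_integral
        (K / 2 * exp (2 * C * (t - a)) - K / 2 * exp (2 * C * (a - a)))) {a..t}"
      using at C(1) by (intro fundamental_theorem_of_calculus)
        (auto intro!: derivative_eq_intros simp flip: has_real_derivative_iff_has_vector_derivative)
    note int_exp = this
    have "norm (D (Suc n) t) \<le> integral {a..t} (\<lambda>u. C * K * exp (2 * C * (u - a)))"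
      unfolding D_Suc P_def
    proof (rule integral_norm_bound_integral)
      show "(\<lambda>u. prod (A (last_point T u)) (D n (last_point T u))) integrable_on {a..t}"
        by (rule int[OF AX[OF D_cont]])
      show "(\<lambda>u. C * K * exp (2 * C * (u - a))) integrable_on {a..t}"
        using int_exp by blast
      fix u assume u: "u \<in> {a..t}"
      then have l: "last_point T u \<in> T" "a \<le> last_point T u" "last_point T u \<le> u" "u \<le> b"
        using last Suc.prems by auto
      then have "norm (prod (A (last_point T u)) (D n (last_point T u))) \<le> C * norm (D n (last_point T u))"
        by (intro C(2)) auto
      also have "\<dots> \<le> C * (K * exp (2 * C * (last_point T u - a)))"
        using l Suc.IH[of "last_point T u"] C(1) by (intro mult_left_mono) (auto simp: K_def)
      \<comment> \<open>The weight is increasing and the last point does not exceed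
        \<open>u\<close>, so the step function may be replaced by a smooth integrand.\<close>
      also have "\<dots> \<le> C * (K * exp (2 * C * (u - a)))"
        using l C(1) K by (intro mult_left_mono) auto
      finally show "norm (prod (A (last_point T u)) (D n (last_point T u))) \<le> C * K * exp (2 * C * (u - a))"
        by simp
    qed
    also have "\<dots> \<le> K / 2 * exp (2 * C * (t - a))"
      using integral_unique[OF int_exp] K by simp
    finally show ?case by (simp add: K_def)
  qed
  define X where "X t = (\<Sum>n. D n t)" for t
  have unif: "uniform_limit (T \<inter> {..b}) (\<lambda>n t. \<Sum>i<n. D i t) X sequentially" for b
  proof -
    obtain C where C: "C > 0" "\<And>t x. t \<in> T \<Longrightarrow> t \<le> b \<Longrightarrow> norm (prod (A t) x) \<le> C * norm x"
      using bound[of b] by blast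
    show ?thesis unfolding X_def
    proof (rule Weierstrass_m_test)
      show "summable (\<lambda>n. norm x0 * exp (2 * C * (b - a)) * (1/2) ^ n)"
        by (intro summable_mult summable_geometric) simp
      fix n t assume "t \<in> T \<inter> {..b}"
      then have t: "t \<in> T" "t \<le> b" by auto
      have "norm (D n t) \<le> norm x0 * (1/2) ^ n * exp (2 * C * (t - a))"
        by (rule D_bound[OF C t])
      also have "\<dots> \<le> norm x0 * (1/2) ^ n * exp (2 * C * (b - a))"
        using t C(1) by (intro mult_left_mono) auto
      finally show "norm (D n t) \<le> norm x0 * exp (2 * C * (b - a)) * (1/2) ^ n" by (simp add: algebra_simps)
    qed
  qed
  have "continuous_on (T \<inter> {..b}) X" for b
    by (rule uniform_limit_theorem[OF _ unif])
       (auto intro!: always_eventually continuous_on_sum continuous_on_subset[OF D_cont])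
  have X_cont: "continuous_on T X"
    unfolding continuous_on_eq_continuous_within
  proof
    fix t assume t: "t \<in> T"
    have "continuous (at t within T \<inter> {..t+1}) X"
      using \<open>continuous_on (T \<inter> {..t+1}) X\<close> t by (simp add: continuous_on_eq_continuous_within)
    \<comment> \<open>The cut at \<open>t + 1\<close> leaves a neighbourhood of \<open>t\<close>
      untouched, which turns continuity on bounded parts into continuity on
      \<open>T\<close>.\<close>
    moreover have "at t within T \<inter> {..t+1} = at t within T"
      by (rule at_within_nhd[of _ "{..<t+1}"]) auto
    ultimately show "continuous (at t within T) X" by simp
  qed
  have X_eq: "X t = x0 + P (\<lambda>t. prod (A t) (X t)) t" if t: "t \<in> T" for t
  proof -
    define S where "S n t = (\<Sum>i<n. D i t)" for n t
    have S_cont: "continuous_on T (S n)" for n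
      unfolding S_def by (intro continuous_on_sum D_cont)
    have S_Suc: "S (Suc n) t = x0 + P (\<lambda>t. prod (A t) (S n t)) t" for n
    proof -
      have "S (Suc n) t = x0 + (\<Sum>i<n. P (\<lambda>t. prod (A t) (D i t)) t)"
        unfolding S_def by (subst sum.lessThan_Suc_shift) (simp add: D_0 D_Suc)
      also have "(\<Sum>i<n. P (\<lambda>t. prod (A t) (D i t)) t) = P (\<lambda>t. prod (A t) (S n t)) t"
        unfolding P_def S_def sum_right
        by (rule integral_sum[symmetric]) (auto intro: int[OF AX[OF D_cont]])
      finally show ?thesis .
    qed
    obtain C where C: "C > 0" "\<And>s x. s \<in> T \<Longrightarrow> s \<le> t \<Longrightarrow> norm (prod (A s) x) \<le> C * norm x"
      using bound[of t] by blast
    have at: "a \<le> t" using T(3) t by auto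
    have lim: "(\<lambda>n. P (\<lambda>t. prod (A t) (S n t)) t) \<longlonglongrightarrow> P (\<lambda>t. prod (A t) (X t)) t"
    proof (rule tendstoI)
      fix e :: real assume e: "e > 0"
      \<comment> \<open>The summand \<open>1\<close> keeps the denominator positive at
        \<open>t = a\<close> and makes the last estimate strict.\<close>
      define e' where "e' = e / (C * (t - a) + 1)"
      have pos: "C * (t - a) + 1 > 0" using C(1) at by (intro add_nonneg_pos) auto
      have e': "e' > 0" using e pos by (simp add: e'_def)
      have "\<forall>\<^sub>F n in sequentially. \<forall>s\<in>T \<inter> {..t}. dist (S n s) (X s) < e'"
        using uniform_limitD[OF unif e'] by (simp add: S_def)
      then show "\<forall>\<^sub>F n in sequentially. dist (P (\<lambda>t. prod (A t) (S n t)) t) (P (\<lambda>t. prod (A t) (X t)) t) < e"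
      proof eventually_elim
        case (elim n)
        have "P (\<lambda>t. prod (A t) (S n t)) t - P (\<lambda>t. prod (A t) (X t)) t
          = integral {a..t} (\<lambda>u. prod (A (last_point T u)) (S n (last_point T u) - X (last_point T u)))"
          unfolding P_def diff_right
          by (rule Henstock_Kurzweil_Integration.integral_diff[symmetric]) (auto intro: int[OF AX] S_cont X_cont)
        also have "norm \<dots> \<le> integral {a..t} (\<lambda>u. C * e')"
        proof (rule integral_norm_bound_integral)
          show "(\<lambda>u. prod (A (last_point T u)) (S n (last_point T u) - X (last_point T u))) integrable_on {a..t}"
            using S_cont X_cont by (intro int[OF AX] continuous_intros)
          fix u assume u: "u \<in> {a..t}"
          then have l: "last_point T u \<in> T" "last_point T u \<le> t"
            using last[of u] by auto
          then have "norm (prod (A (last_point T u)) (S n (last_point T u) - X (last_point T u)))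
            \<le> C * norm (S n (last_point T u) - X (last_point T u))"
            by (intro C(2)) auto
          also have "\<dots> \<le> C * e'"
            using elim l C(1) by (intro mult_left_mono) (auto simp: dist_norm intro: less_imp_le)
          finally show "norm (prod (A (last_point T u)) (S n (last_point T u) - X (last_point T u))) \<le> C * e'" .
        qed auto
        also have "\<dots> = C * (t - a) * e'" using at by simp
        also have "\<dots> < (C * (t - a) + 1) * e'" using e' by (simp add: algebra_simps)
        also have "\<dots> = e" using pos by (simp add: e'_def)
        finally show ?case by (simp add: dist_norm)
      qed
    qed
    have "(\<lambda>n. S (Suc n) t) \<longlonglongrightarrow> X t"
      using tendsto_uniform_limitI[OF unif[of t], of t] t by (subst filterlim_sequentially_Suc) (simp add: S_def)
    moreover have "(\<lambda>n. S (Suc n) t) \<longlonglongrightarrow> x0 + P (\<lambda>t. prod (A t) (X t)) t"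
      unfolding S_Suc by (intro tendsto_intros lim)
    ultimately show ?thesis by (rule LIMSEQ_unique)
  qed
  show thesis
  proof (rule that)
    show "X a = x0" using X_eq[OF T(2)] by (simp add: P_def)
    fix t assume t: "t \<in> T"
    have "has_delta_derivative T (\<lambda>s. x0 + P (\<lambda>t. prod (A t) (X t)) s) (prod (A t) (X t)) t"
      using P_deriv[OF AX[OF X_cont] t] by (simp add: has_delta_derivative_def)
    then show "has_delta_derivative T X (prod (A t) (X t)) t"
      
      using has_delta_derivative_transform[OF t T(1), of "\<lambda>s. x0 + P (\<lambda>t. prod (A t) (X t)) s" X]
        X_eq by metis
  qed
qed

section \<open>Fundamental solutions and transition matrices\<close>

lemma bounded_bilinear_matrix_mult:
  "bounded_bilinear ((**) :: 'a::{real_normed_field, euclidean_space}^'n^'m \<Rightarrow> 'a^'k^'n \<Rightarrow> 'a^'k^'m)"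
  unfolding bilinear_conv_bounded_bilinear[symmetric] bilinear_def
proof (intro conjI allI linearI)
  fix x y :: "'a^'n^'m" and z w :: "'a^'k^'n" and r :: real
  show "x ** (z + w) = x ** z + x ** w" by (rule matrix_add_ldistrib)
  show "(x + y) ** z = x ** z + y ** z"
    by (simp add: vec_eq_iff matrix_matrix_mult_def sum.distrib distrib_right)
  show "x ** (r *\<^sub>R z) = r *\<^sub>R (x ** z)" by (simp add: matrix_scalar_ac scalar_matrix_assoc)
  show "(r *\<^sub>R x) ** z = r *\<^sub>R (x ** z)" by (simp add: scalar_matrix_assoc)
qed

lemmas matrix_mult_diff_left = bounded_bilinear.diff_left[OF bounded_bilinear_matrix_mult]
  and matrix_mult_diff_right = bounded_bilinear.diff_right[OF bounded_bilinear_matrix_mult]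
  and matrix_mult_minus_left = bounded_bilinear.minus_left[OF bounded_bilinear_matrix_mult]
  and matrix_mult_minus_right = bounded_bilinear.minus_right[OF bounded_bilinear_matrix_mult]
  and matrix_mult_add_left = bounded_bilinear.add_left[OF bounded_bilinear_matrix_mult]
  and matrix_mult_add_right = bounded_bilinear.add_right[OF bounded_bilinear_matrix_mult]
  and matrix_mult_zero_left = bounded_bilinear.zero_left[OF bounded_bilinear_matrix_mult]
  and matrix_mult_zero_right = bounded_bilinear.zero_right[OF bounded_bilinear_matrix_mult]
  and matrix_mult_scaleR_left = bounded_bilinear.scaleR_left[OF bounded_bilinear_matrix_mult]
  and matrix_mult_scaleR_right = bounded_bilinear.scaleR_right[OF bounded_bilinear_matrix_mult]

lemma invertible_matrix_inv:
  fixes A :: "'a::field^'n^'n"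
  assumes "invertible A"
  shows "matrix_inv A ** A = mat 1" "A ** matrix_inv A = mat 1"
  using someI_ex[OF assms[unfolded invertible_def]] by (auto simp: matrix_inv_def)

lemma invertible_mat_1: "invertible (mat 1 :: 'a::field^'n^'n)"
  unfolding invertible_def by (rule exI[of _ "mat 1"]) simp

lemma matrix_inv_eqI:
  fixes A :: "'a::field^'n^'n"
  assumes "B ** A = mat 1"
  shows "matrix_inv A = B"
proof -
  have "invertible A" using assms invertible_left_inverse by blast
  then have "B ** (A ** matrix_inv A) = B" by (simp add: invertible_matrix_inv)
  then show ?thesis by (simp add: matrix_mul_assoc assms)
qed

text \<open>Writing \<open>H\<close> for the inverse of \<open>G x\<close>, the identity
  \<open>H - I = H ** (I - G x)\<close> bounds \<open>norm (H - I)\<close> by a small multiple of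
  \<open>norm H\<close>. Once \<open>norm (I - G x) < 1 / (2 * K)\<close>, half of
  \<open>norm (H - I)\<close> is absorbed on the left.\<close>

lemma tendsto_matrix_inv_one:
  fixes G :: "'b \<Rightarrow> 'a::{real_normed_field, euclidean_space}^'n^'n"
  assumes lim: "(G \<longlongrightarrow> mat 1) F" and inv: "\<And>x. invertible (G x)"
  shows "((\<lambda>x. matrix_inv (G x)) \<longlongrightarrow> mat 1) F"
proof -
  obtain K where K: "K > 0" "\<And>(A :: 'a^'n^'n) (B :: 'a^'n^'n). norm (A ** B) \<le> norm A * norm B * K"
    using bounded_bilinear.pos_bounded[OF bounded_bilinear_matrix_mult] by blast
  define I where "I = (mat 1 :: 'a^'n^'n)"
  have lim0: "((\<lambda>x. norm (I - G x)) \<longlongrightarrow> 0) F"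
    using tendsto_norm[OF tendsto_diff[OF tendsto_const[of I] lim]] by (simp add: I_def)
  have "\<forall>\<^sub>F x in F. norm (I - G x) < 1 / (2 * K)"
    using order_tendstoD(2)[OF lim0, of "1 / (2 * K)"] K(1) by simp
  then have "\<forall>\<^sub>F x in F. norm (matrix_inv (G x) - I) \<le> 2 * K * norm I * norm (I - G x)"
  proof eventually_elim
    case (elim x)
    define H where "H = matrix_inv (G x)"
    have "H - I = H ** (I - G x)"
      using inv[of x] by (simp add: matrix_mult_diff_right H_def I_def invertible_matrix_inv)
    then have "norm (H - I) = norm (H ** (I - G x))" by (rule arg_cong)
    also have "\<dots> \<le> norm H * norm (I - G x) * K" by (rule K(2))
    also have "\<dots> = norm H * (norm (I - G x) * K)" by simp
    also have "\<dots> \<le> (norm (H - I) + norm I) * (norm (I - G x) * K)"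
      using norm_triangle_sub[of H I] K(1) by (intro mult_right_mono) auto
    also have "\<dots> = norm (H - I) * (norm (I - G x) * K) + norm I * norm (I - G x) * K"
      by (simp add: algebra_simps)
    also have "norm (H - I) * (norm (I - G x) * K) \<le> norm (H - I) * (1 / 2)"
      using elim K(1) by (intro mult_left_mono) (auto simp: field_simps)
    finally show ?case by (simp add: H_def algebra_simps)
  qed
  moreover have "((\<lambda>x. 2 * K * norm I * norm (I - G x)) \<longlongrightarrow> 0) F"
    using tendsto_mult_right_zero[OF lim0] by blast
  ultimately have "((\<lambda>x. matrix_inv (G x) - I) \<longlongrightarrow> 0) F"
    by (rule Lim_null_comparison)
  then show ?thesis using LIM_zero_iff unfolding I_def by blast
qed

section \<open>Limits of the forward jump and of the graininess\<close>

lemma tendsto_fwd_jump_right_dense: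
  assumes "right_dense T t"
  shows "(fwd_jump T \<longlongrightarrow> t) (at t within T)"
proof (rule tendstoI)
  fix e :: real assume e: "e > 0"
  have "\<exists>s\<in>T. t < s \<and> s < t + e"
  proof (rule ccontr)
    assume "\<not> ?thesis"
    then have "t + e \<le> s" if "s \<in> T" "t < s" for s using that by force
    then have "t + e \<le> Inf {s \<in> T. t < s}"
      using assms by (intro cInf_greatest) (auto simp: right_dense_def)
    then show False using assms e by (auto simp: right_dense_def fwd_jump_def split: if_splits)
  qed
  \<comment> \<open>One point of \<open>T\<close> shortly after \<open>t\<close> bounds the forward
    jumps of all points before it.\<close>
  then obtain s where s: "s \<in> T" "t < s" "s < t + e" by blast
  have "dist (fwd_jump T r) t < e" if "r \<in> T" "dist r t < min e (s - t)" for r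
  proof -
    have "r < s" "t - e < r" using that by (auto simp: dist_real_def)
    then show ?thesis
      using fwd_jump_le[OF s(1), of r] fwd_jump_ge[of r T] s by (simp add: dist_real_def)
  qed
  then show "\<forall>\<^sub>F r in at t within T. dist (fwd_jump T r) t < e"
    unfolding eventually_at using e s by (intro exI[of _ "min e (s - t)"]) auto
qed

lemma tendsto_fwd_jump_left:
  assumes "t \<in> T"
  shows "(fwd_jump T \<longlongrightarrow> t) (at t within (T \<inter> {..<t}))"
proof (rule tendstoI)
  fix e :: real assume e: "e > 0"
  have "dist (fwd_jump T r) t < e" if "r \<in> T" "r < t" "dist r t < e" for r
    using fwd_jump_le[OF assms, of r] fwd_jump_ge[of r T] that by (simp add: dist_real_def)
  then show "\<forall>\<^sub>F r in at t within (T \<inter> {..<t}). dist (fwd_jump T r) t < e"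
    unfolding eventually_at using e by (intro exI[of _ e]) auto
qed

text \<open>The forward jump tends to \<open>t\<close> at right-dense points, where it equals
  \<open>t\<close>, and from the left at every point of \<open>T\<close>. This is needed for the
  term \<open>L (fwd_jump T t)\<close> in the derivative of the periodic factor.\<close>

lemma rd_continuous_comp_fwd_jump:
  assumes T: "closed T" and F: "continuous_on T F"
  shows "rd_continuous T (\<lambda>t. F (fwd_jump T t))"
proof -
  have lim: "((\<lambda>r. F (fwd_jump T r)) \<longlongrightarrow> F t) (at t within S)"
    if "(fwd_jump T \<longlongrightarrow> t) (at t within S)" "t \<in> T" "S \<subseteq> T" for t S
    using F that(1,2)
    by (rule continuous_on_tendsto_compose)
       (use that(3) T in \<open>auto simp: eventually_at_filter intro!: always_eventually fwd_jump_mem\<close>)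
  show ?thesis
    unfolding rd_continuous_def continuous_within
  proof (intro conjI ballI impI)
    fix t assume t: "t \<in> T"
    show "((\<lambda>r. F (fwd_jump T r)) \<longlongrightarrow> F (fwd_jump T t)) (at t within T)" if "right_dense T t"
      using lim[OF tendsto_fwd_jump_right_dense[OF that] t] that by (simp add: right_dense_def)
    show "\<exists>l. ((\<lambda>r. F (fwd_jump T r)) \<longlongrightarrow> l) (at t within T \<inter> {..<t})"
      using lim[OF tendsto_fwd_jump_left[OF t] t] by blast
  qed
qed

lemma tendsto_graininess_right_dense:
  "right_dense T t \<Longrightarrow> (graininess T \<longlongrightarrow> 0) (at t within T)"
  using tendsto_diff[OF tendsto_fwd_jump_right_dense tendsto_ident_at, of T t]
  by (simp add: graininess_def[abs_def])

lemma tendsto_graininess_left: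
  "t \<in> T \<Longrightarrow> (graininess T \<longlongrightarrow> 0) (at t within (T \<inter> {..<t}))"
  using tendsto_diff[OF tendsto_fwd_jump_left[of t T] tendsto_ident_at]
  by (simp add: graininess_def[abs_def])

lemma graininess_right_dense: "right_dense T t \<Longrightarrow> graininess T t = 0"
  by (simp add: right_dense_def graininess_def)

text \<open>In every limit that rd-continuity tests, the graininess tends to \<open>0\<close>
  through nonnegative values, so only the behaviour of \<open>h\<close> at \<open>0\<close> from the
  right matters.\<close>

lemma rd_continuous_comp_graininess:
  assumes h: "(h \<longlongrightarrow> h 0) (at 0 within {0..})"
  shows "rd_continuous T (\<lambda>t. h (graininess T t))"
proof -
  have lim: "((\<lambda>r. h (graininess T r)) \<longlongrightarrow> h 0) F" if "(graininess T \<longlongrightarrow> 0) F" for F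
    using h by (intro continuous_within_tendsto_compose'[OF _ _ that, of "{0..}"])
      (simp_all add: continuous_within graininess_nonneg)
  show ?thesis
    unfolding rd_continuous_def continuous_within
    using lim[OF tendsto_graininess_right_dense] lim[OF tendsto_graininess_left]
    by (auto simp: graininess_right_dense)
qed

text \<open>\<open>Z\<close> is the inverse of \<open>X\<close>. Demanding its own equation, with
  the jump on \<open>Z\<close>, makes the derivative of \<open>Z t ** Y t\<close> vanish for every
  solution \<open>Y\<close>, without a rule for differentiating inverses.\<close>

definition fundamental_pair ::
    "real set \<Rightarrow> (real \<Rightarrow> 'a::real_normed_field^'n^'n) \<Rightarrow> (real \<Rightarrow> 'a^'n^'n) \<Rightarrow> (real \<Rightarrow> 'a^'n^'n) \<Rightarrow> bool" where
  "fundamental_pair T A X Z \<longleftrightarrow> (\<forall>t\<in>T. has_delta_derivative T X (A t ** X t) t \<and>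
     has_delta_derivative T Z (- (Z (fwd_jump T t) ** A t)) t \<and> Z t ** X t = mat 1)"

lemma fundamental_pair_inverse:
  assumes "fundamental_pair T A X Z" "t \<in> T"
  shows "Z t ** X t = mat 1" "X t ** Z t = mat 1"
  using assms matrix_left_right_inverse[of "X t" "Z t"] by (auto simp: fundamental_pair_def)

text \<open>By the product rule \<open>Z t ** Y t\<close> has derivative
  \<open>- Z\<^sup>\<sigma> A Y + Z\<^sup>\<sigma> A Y = 0\<close>, hence it is constant.\<close>

lemma fundamental_pair_unique:
  fixes A :: "real \<Rightarrow> 'a::{real_normed_field, euclidean_space}^'n^'n"
  assumes T: "closed T" and XZ: "fundamental_pair T A X Z"
    and Y: "\<And>t. t \<in> T \<Longrightarrow> has_delta_derivative T Y (A t ** Y t) t"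
    and st: "s \<in> T" "t \<in> T"
  shows "Y t = X t ** Z s ** Y s"
proof -
  have "has_delta_derivative T (\<lambda>t. Z t ** Y t) 0 t" if t: "t \<in> T" for t
  proof -
    have "has_delta_derivative T Z (- (Z (fwd_jump T t) ** A t)) t"
      using XZ t by (simp add: fundamental_pair_def)
    from bounded_bilinear.has_delta_derivative[OF bounded_bilinear_matrix_mult t this Y[OF t]]
    show ?thesis by (simp add: matrix_mult_minus_left matrix_mul_assoc)
  qed
  then have "Z t ** Y t = Z s ** Y s"
    by (rule delta_derivative_zero_imp_const[OF T _ st(2,1)])
  then have "X t ** (Z t ** Y t) = X t ** (Z s ** Y s)" by simp
  then show ?thesis using fundamental_pair_inverse(2)[OF XZ st(2)] by (simp add: matrix_mul_assoc)
qed

lemma fundamental_pair_solves: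
  fixes A :: "real \<Rightarrow> 'a::{real_normed_field, euclidean_space}^'n^'n"
  assumes XZ: "fundamental_pair T A X Z" and t: "t \<in> T"
  shows "has_delta_derivative T (\<lambda>s. X s ** C) (A t ** (X t ** C)) t"
  using bounded_linear.has_delta_derivative[OF
      bounded_bilinear.bounded_linear_left[OF bounded_bilinear_matrix_mult] t] XZ t
  by (force simp: fundamental_pair_def matrix_mul_assoc)

lemma transition_matrix_eq:
  fixes A :: "real \<Rightarrow> 'a::{real_normed_field, euclidean_space}^'n^'n"
  assumes T: "closed T" and XZ: "fundamental_pair T A X Z" and t: "t \<in> T" "\<tau> \<in> T"
  shows "transition_matrix T A t \<tau> = X t ** Z \<tau>"
  unfolding transition_matrix_def
proof (rule the_equality)
  have "solves_matrix_ivp T A \<tau> (\<lambda>s. X s ** Z \<tau>)"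
    unfolding solves_matrix_ivp_def
    using fundamental_pair_solves[OF XZ] fundamental_pair_inverse[OF XZ t(2)] by blast
  then show "\<exists>Y. solves_matrix_ivp T A \<tau> Y \<and> X t ** Z \<tau> = Y t" by blast
  show "Y = X t ** Z \<tau>" if Y: "\<exists>X. solves_matrix_ivp T A \<tau> X \<and> Y = X t" for Y
  proof -
    obtain V where V: "solves_matrix_ivp T A \<tau> V" "Y = V t" using Y by blast
    then have "V t = X t ** Z \<tau> ** V \<tau>"
      by (intro fundamental_pair_unique[OF T XZ _ t(2,1)]) (simp add: solves_matrix_ivp_def)
    then show ?thesis using V by (simp add: solves_matrix_ivp_def)
  qed
qed

text \<open>The equation of \<open>Z\<close> is implicit, since its right side contains the value at
  the forward jump. Regressivity resolves it to \<open>Z\<^sup>\<Delta> = Z B\<close> with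
  \<open>B = - (I + \<mu> A)\<^sup>-\<^sup>1 A\<close>, which is again a linear initial value
  problem.\<close>

lemma fundamental_pair_from_minimum:
  fixes A :: "real \<Rightarrow> 'a::{real_normed_field, euclidean_space}^'n^'n"
  assumes T: "closed T" "a \<in> T" "\<And>t. t \<in> T \<Longrightarrow> a \<le> t" and unb: "\<And>t. t \<in> T \<Longrightarrow> \<exists>s\<in>T. t < s"
    and A: "regressive T A"
  obtains X Z where "fundamental_pair T A X Z"
proof -
  define V where "V t = mat 1 + graininess T t *\<^sub>R A t" for t
  \<comment> \<open>The value \<open>mat 1\<close> off \<open>T\<close> reflects that regressivity
    says nothing there, while the limit of inverses is stated for an everywhere invertible
    function.\<close>
  define U where "U t = (if t \<in> T then matrix_inv (V t) else mat 1)" for t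
  define B where "B t = - (U t ** A t)" for t
  have rdA: "rd_continuous T A" and inv: "\<And>t. t \<in> T \<Longrightarrow> invertible (V t)"
    using A by (auto simp: regressive_def V_def)
  have ev: "\<forall>\<^sub>F x in at t within S. x \<in> T" if "S \<subseteq> T" for t :: real and S
    using that by (auto simp: eventually_at_filter intro!: always_eventually)
  \<comment> \<open>Wherever \<open>A\<close> has a limit and the graininess tends to
    \<open>0\<close>, the matrix \<open>V\<close> tends to the identity; thus continuity of
    inversion is needed at the identity only.\<close>
  have U_lim: "(U \<longlongrightarrow> mat 1) (at t within S)"
    if S: "S \<subseteq> T" and g: "(graininess T \<longlongrightarrow> 0) (at t within S)" and l: "(A \<longlongrightarrow> l) (at t within S)" for t S l
  proof -
    have "(V \<longlongrightarrow> mat 1 + 0 *\<^sub>R l) (at t within S)"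
      unfolding V_def by (intro tendsto_intros g l)
    then have "(V \<longlongrightarrow> mat 1) (at t within S)" by simp
    then have "((\<lambda>t. if t \<in> T then V t else mat 1) \<longlongrightarrow> mat 1) (at t within S)"
      by (rule Lim_transform_eventually) (use ev[OF S, of t] in \<open>auto elim: eventually_mono\<close>)
    then have "((\<lambda>t. matrix_inv (if t \<in> T then V t else mat 1)) \<longlongrightarrow> mat 1) (at t within S)"
      by (rule tendsto_matrix_inv_one) (auto simp: inv intro!: invertible_mat_1)
    then show ?thesis
      by (rule Lim_transform_eventually) (use eventually_mono[OF ev[OF S, of t]] in \<open>auto simp: U_def\<close>)
  qed
  have "rd_continuous T U"
    unfolding rd_continuous_def continuous_within
  proof (intro conjI ballI impI)
    fix t assume t: "t \<in> T" "right_dense T t"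
    have "U t = mat 1"
      using t graininess_right_dense[OF t(2)] by (simp add: U_def V_def matrix_inv_eqI)
    moreover have "(U \<longlongrightarrow> mat 1) (at t within T)"
      using rdA t by (intro U_lim[of _ _ "A t"] tendsto_graininess_right_dense)
        (auto simp: rd_continuous_def continuous_within)
    ultimately show "(U \<longlongrightarrow> U t) (at t within T)" by simp
  next
    fix t assume t: "t \<in> T" "left_dense T t"
    then obtain l where "(A \<longlongrightarrow> l) (at t within (T \<inter> {..<t}))"
      using rdA by (auto simp: rd_continuous_def)
    then show "\<exists>l. (U \<longlongrightarrow> l) (at t within (T \<inter> {..<t}))"
      using U_lim[OF _ tendsto_graininess_left[OF t(1)]] by blast
  qed
  then have "rd_continuous T (\<lambda>t. U t ** A t)"
    using rdA by (rule bounded_bilinear.rd_continuous[OF bounded_bilinear_matrix_mult])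
  from rd_continuous_diff[OF rd_continuous_continuous_on[OF continuous_on_const] this, of 0]
  have rdB: "rd_continuous T B" by (simp add: B_def[abs_def])
  obtain X where X: "X a = mat 1" "\<And>t. t \<in> T \<Longrightarrow> has_delta_derivative T X (A t ** X t) t"
    using linear_ivp_solution[OF T unb bounded_bilinear_matrix_mult rdA] by blast
  obtain Z where Z: "Z a = mat 1" "\<And>t. t \<in> T \<Longrightarrow> has_delta_derivative T Z (Z t ** B t) t"
    \<comment> \<open>Flipping the product puts the unknown on the left of the coefficient.\<close>
    using linear_ivp_solution[OF T unb bounded_bilinear.flip[OF bounded_bilinear_matrix_mult] rdB] by blast
  have Z_deriv: "Z t ** B t = - (Z (fwd_jump T t) ** A t)" if t: "t \<in> T" for t
  proof -
    have Zs: "Z (fwd_jump T t) = Z t + graininess T t *\<^sub>R (Z t ** B t)"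
      by (rule has_delta_derivative_fwd_jump[OF t Z(2)[OF t]])
    have "U t ** V t = mat 1" using inv[OF t] t by (simp add: U_def invertible_matrix_inv)
    then have UV: "U t + graininess T t *\<^sub>R (U t ** A t) = mat 1"
      by (simp add: V_def matrix_mult_add_right matrix_mult_scaleR_right)
    \<comment> \<open>Since \<open>mat 1 - graininess T t *\<^sub>R (U t ** A t)\<close> is
      \<open>U t\<close>, the jump value is \<open>Z t ** U t\<close>, and \<open>Z t ** B t\<close>
      takes the implicit form.\<close>
    have "Z (fwd_jump T t) = Z t ** (mat 1 - graininess T t *\<^sub>R (U t ** A t))"
      by (simp add: Zs B_def matrix_mult_diff_right matrix_mult_minus_right matrix_mult_scaleR_right)
    also have "mat 1 - graininess T t *\<^sub>R (U t ** A t) = U t"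
      using UV by (simp add: algebra_simps)
    finally show ?thesis by (simp add: B_def matrix_mult_minus_right matrix_mul_assoc)
  qed
  have "Z t ** X t = mat 1" if t: "t \<in> T" for t
  proof -
    have "has_delta_derivative T (\<lambda>t. Z t ** X t) 0 t" if t: "t \<in> T" for t
      using bounded_bilinear.has_delta_derivative[OF bounded_bilinear_matrix_mult t Z(2)[OF t] X(2)[OF t]]
      by (simp add: Z_deriv[OF t] matrix_mult_minus_left matrix_mul_assoc)
    from delta_derivative_zero_imp_const[OF T(1) this t T(2)]
    show ?thesis by (simp add: X Z)
  qed
  then have "fundamental_pair T A X Z"
    using X Z Z_deriv by (simp add: fundamental_pair_def)
  then show thesis by (rule that)
qed

section \<open>Restriction to the upper parts of a time scale\<close>

lemma fwd_jump_Int_atLeast: "a \<le> t \<Longrightarrow> fwd_jump (T \<inter> {a..}) t = fwd_jump T t"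
proof -
  assume "a \<le> t"
  then have "{s \<in> T \<inter> {a..}. t < s} = {s \<in> T. t < s}" "(\<exists>s\<in>T \<inter> {a..}. t < s) \<longleftrightarrow> (\<exists>s\<in>T. t < s)"
    by force+
  then show ?thesis by (simp add: fwd_jump_def)
qed

lemma graininess_Int_atLeast: "a \<le> t \<Longrightarrow> graininess (T \<inter> {a..}) t = graininess T t"
  by (simp add: graininess_def fwd_jump_Int_atLeast)

lemma rd_continuous_Int_atLeast:
  assumes "rd_continuous T f"
  shows "rd_continuous (T \<inter> {a..}) f"
  unfolding rd_continuous_def
proof (intro conjI ballI impI)
  fix t assume t: "t \<in> T \<inter> {a..}" "right_dense (T \<inter> {a..}) t"
  then have "right_dense T t" by (auto simp: right_dense_def fwd_jump_Int_atLeast)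
  then have "continuous (at t within T) f" using assms t by (auto simp: rd_continuous_def)
  then show "continuous (at t within T \<inter> {a..}) f" by (rule continuous_within_subset) auto
next
  fix t assume t: "t \<in> T \<inter> {a..}" "left_dense (T \<inter> {a..}) t"
  have "Sup {s \<in> T. s < t} = t"
  proof (rule antisym)
    show "Sup {s \<in> T. s < t} \<le> t" using t by (intro cSup_least) (auto simp: left_dense_def)
    have "Sup {s \<in> T \<inter> {a..}. s < t} \<le> Sup {s \<in> T. s < t}"
      using t by (intro cSup_subset_mono) (auto simp: left_dense_def intro!: bdd_aboveI[of _ t])
    then show "t \<le> Sup {s \<in> T. s < t}" using t by (simp add: left_dense_def)
  qed
  then have "left_dense T t" using t by (auto simp: left_dense_def)
  then obtain l where "(f \<longlongrightarrow> l) (at t within (T \<inter> {..<t}))"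
    using assms t by (auto simp: rd_continuous_def)
  then have "(f \<longlongrightarrow> l) (at t within (T \<inter> {a..} \<inter> {..<t}))"
    by (rule tendsto_within_subset) auto
  then show "\<exists>l. (f \<longlongrightarrow> l) (at t within (T \<inter> {a..} \<inter> {..<t}))" by blast
qed

lemma has_delta_derivative_Int_atLeast:
  "has_delta_derivative T F d t \<Longrightarrow> a \<le> t \<Longrightarrow> has_delta_derivative (T \<inter> {a..}) F d t"
  unfolding has_delta_derivative_def by (simp add: fwd_jump_Int_atLeast) blast

lemma fundamental_pair_Int_atLeast:
  assumes "fundamental_pair (T \<inter> {a..}) A X Z" "a \<le> b"
  shows "fundamental_pair (T \<inter> {b..}) A X Z"
proof -
  have eq: "T \<inter> {a..} \<inter> {b..} = T \<inter> {b..}" using assms(2) by auto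
  show ?thesis
    unfolding fundamental_pair_def
  proof
    fix t assume t: "t \<in> T \<inter> {b..}"
    then have at: "a \<le> t" "b \<le> t" "t \<in> T \<inter> {a..}" using assms(2) by auto
    then have "has_delta_derivative (T \<inter> {a..}) X (A t ** X t) t"
      "has_delta_derivative (T \<inter> {a..}) Z (- (Z (fwd_jump T t) ** A t)) t" "Z t ** X t = mat 1"
      using assms(1) by (auto simp: fundamental_pair_def fwd_jump_Int_atLeast)
    then show "has_delta_derivative (T \<inter> {b..}) X (A t ** X t) t \<and>
      has_delta_derivative (T \<inter> {b..}) Z (- (Z (fwd_jump (T \<inter> {b..}) t) ** A t)) t \<and> Z t ** X t = mat 1"
      using has_delta_derivative_Int_atLeast[of "T \<inter> {a..}" X _ t b, unfolded eq]
        has_delta_derivative_Int_atLeast[of "T \<inter> {a..}" Z _ t b, unfolded eq] at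
      by (simp add: fwd_jump_Int_atLeast)
  qed
qed

text \<open>Solutions started at arbitrarily early points and normalised at a common \<open>t0\<close> fit together.\<close>

lemma regressive_fundamental_pair:
  fixes A :: "real \<Rightarrow> 'a::{real_normed_field, euclidean_space}^'n^'n"
  assumes T: "closed T" "t0 \<in> T" and unb: "\<And>t. t \<in> T \<Longrightarrow> \<exists>s\<in>T. t < s" and A: "regressive T A"
  obtains X Z where "fundamental_pair T A X Z"
proof -
  \<comment> \<open>Multiplying \<open>X\<close> by \<open>Z t0\<close> on the right and
    \<open>Z\<close> by \<open>X t0\<close> on the left preserves the pair and makes the solution
    the identity at \<open>t0\<close>, whatever the start \<open>a\<close>.\<close>
  have ex: "\<exists>X Z. fundamental_pair (T \<inter> {a..}) A X Z \<and> X t0 = mat 1" if a: "a \<in> T" "a \<le> t0" for a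
  proof -
    have "regressive (T \<inter> {a..}) A"
      using A by (auto simp: regressive_def rd_continuous_Int_atLeast graininess_Int_atLeast)
    moreover have "\<exists>s\<in>T \<inter> {a..}. t < s" if "t \<in> T \<inter> {a..}" for t using unb[of t] that by force
    ultimately obtain X Z where XZ: "fundamental_pair (T \<inter> {a..}) A X Z"
      using fundamental_pair_from_minimum[of "T \<inter> {a..}" a A] T a by (auto simp: closed_Int)
    note inv = fundamental_pair_inverse[OF XZ]
    have t0: "t0 \<in> T \<inter> {a..}" using a T by auto
    have "fundamental_pair (T \<inter> {a..}) A (\<lambda>t. X t ** Z t0) (\<lambda>t. X t0 ** Z t)"
      unfolding fundamental_pair_def
    proof (intro ballI conjI)
      fix t assume t: "t \<in> T \<inter> {a..}"
      show "has_delta_derivative (T \<inter> {a..}) (\<lambda>t. X t ** Z t0) (A t ** (X t ** Z t0)) t"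
        by (rule fundamental_pair_solves[OF XZ t])
      have "has_delta_derivative (T \<inter> {a..}) (\<lambda>s. X t0 ** Z s)
        (X t0 ** - (Z (fwd_jump (T \<inter> {a..}) t) ** A t)) t"
        using XZ t
        by (intro bounded_linear.has_delta_derivative[OF
            bounded_bilinear.bounded_linear_right[OF bounded_bilinear_matrix_mult] t])
           (simp add: fundamental_pair_def)
      then show "has_delta_derivative (T \<inter> {a..}) (\<lambda>s. X t0 ** Z s)
        (- (X t0 ** Z (fwd_jump (T \<inter> {a..}) t) ** A t)) t"
        by (simp add: matrix_mult_minus_right matrix_mul_assoc)
      have "X t0 ** Z t ** (X t ** Z t0) = X t0 ** (Z t ** X t) ** Z t0"
        by (simp add: matrix_mul_assoc)
      then show "X t0 ** Z t ** (X t ** Z t0) = mat 1" using inv[OF t] inv[OF t0] by simp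
    qed
    moreover have "X t0 ** Z t0 = mat 1" using inv[OF t0] by simp
    ultimately show ?thesis by blast
  qed
  define P where "P a = (SOME XZ. fundamental_pair (T \<inter> {a..}) A (fst XZ) (snd XZ) \<and> fst XZ t0 = mat 1)" for a
  have P: "fundamental_pair (T \<inter> {a..}) A (fst (P a)) (snd (P a))" "fst (P a) t0 = mat 1"
    if "a \<in> T" "a \<le> t0" for a
  proof -
    have "\<exists>XZ. fundamental_pair (T \<inter> {a..}) A (fst XZ) (snd XZ) \<and> fst XZ t0 = mat 1"
      using ex[OF that] by force
    from someI_ex[OF this] show "fundamental_pair (T \<inter> {a..}) A (fst (P a)) (snd (P a))" "fst (P a) t0 = mat 1"
      by (auto simp: P_def)
  qed
  \<comment> \<open>On the smaller piece both are solutions with value \<open>mat 1\<close> at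
    \<open>t0\<close>, so uniqueness identifies them; the inverses then agree as well.\<close>
  have consistent_le: "fst (P a) t = fst (P b) t \<and> snd (P a) t = snd (P b) t"
    if "a \<in> T" "a \<le> b" "b \<in> T" "b \<le> t0" "b \<le> t" "t \<in> T" for a b t
  proof -
    have a: "a \<le> t0" using that by simp
    have t: "t \<in> T \<inter> {b..}" "t0 \<in> T \<inter> {b..}" using that T by auto
    note Pa = fundamental_pair_Int_atLeast[OF P(1)[OF that(1) a] that(2)] and Pb = P(1)[OF that(3,4)]
    have cl: "closed (T \<inter> {b..})" using T by (simp add: closed_Int)
    have "fst (P a) t = fst (P b) t ** snd (P b) t0 ** fst (P a) t0"
      using Pa by (intro fundamental_pair_unique[OF cl Pb _ t(2,1)]) (auto simp: fundamental_pair_def)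
    moreover have "snd (P b) t0 = mat 1"
      using fundamental_pair_inverse(1)[OF Pb t(2)] P(2)[OF that(3,4)] by simp
    ultimately have eq: "fst (P a) t = fst (P b) t" using P(2)[OF that(1) a] by simp
    have "snd (P a) t = snd (P a) t ** (fst (P b) t ** snd (P b) t)"
      using fundamental_pair_inverse(2)[OF Pb t(1)] by simp
    also have "\<dots> = snd (P b) t"
      using fundamental_pair_inverse(1)[OF Pa t(1)] by (simp add: matrix_mul_assoc flip: eq)
    finally show ?thesis using eq by simp
  qed
  \<comment> \<open>The start has to lie below both \<open>t\<close> and \<open>t0\<close>;
    \<open>min t t0\<close> is one such point of \<open>T\<close>, and \<open>XZ\<close> shows that
    any other gives the same value.\<close>
  define X where "X t = fst (P (min t t0)) t" for t
  define Z where "Z t = snd (P (min t t0)) t" for t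
  have XZ: "X t = fst (P a) t" "Z t = snd (P a) t" if "a \<in> T" "a \<le> t0" "a \<le> t" "t \<in> T" for a t
    using consistent_le[of a "min t t0" t] that T by (auto simp: X_def Z_def min_def split: if_splits)
  have "fundamental_pair T A X Z"
    unfolding fundamental_pair_def
  proof (intro ballI)
    fix t assume t: "t \<in> T"
    \<comment> \<open>The derivative at \<open>t\<close> also looks to the left, so the piece has to
      contain all points of \<open>T\<close> near \<open>t\<close>: it starts strictly before
      \<open>t\<close> unless \<open>t\<close> is the minimum.\<close>
    have "\<exists>a \<delta>. a \<in> T \<and> a \<le> t \<and> a \<le> t0 \<and> \<delta> > 0 \<and> (\<forall>s\<in>T. \<bar>s - t\<bar> < \<delta> \<longrightarrow> a \<le> s)"
    proof (cases "\<exists>a\<in>T. a < t")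
      case True
      then obtain a where "a \<in> T" "a < t" by blast
      then show ?thesis using T
        by (intro exI[of _ "min a t0"] exI[of _ "t - a"]) (auto simp: min_def)
    next
      case False
      then show ?thesis using T t by (intro exI[of _ t] exI[of _ 1]) (auto simp: not_less)
    qed
    then obtain a \<delta> where a: "a \<in> T" "a \<le> t" "a \<le> t0" and \<delta>: "\<delta> > 0" "\<And>s. s \<in> T \<Longrightarrow> \<bar>s - t\<bar> < \<delta> \<Longrightarrow> a \<le> s"
      by blast
    have local: "has_delta_derivative T F d t"
      if F: "has_delta_derivative (T \<inter> {a..}) G d t" and FG: "\<And>s. s \<in> T \<Longrightarrow> a \<le> s \<Longrightarrow> F s = G s"
      for F G and d :: "'a^'n^'n"
      unfolding has_delta_derivative_def
    proof (intro allI impI)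
      fix e :: real assume "e > 0"
      with F obtain r where r: "r > 0" "\<And>s. s \<in> T \<Longrightarrow> a \<le> s \<Longrightarrow> \<bar>s - t\<bar> < r \<Longrightarrow>
          norm (G (fwd_jump T t) - G s - (fwd_jump T t - s) *\<^sub>R d) \<le> e * \<bar>fwd_jump T t - s\<bar>"
        unfolding has_delta_derivative_def fwd_jump_Int_atLeast[OF a(2)] by auto
      have "F (fwd_jump T t) = G (fwd_jump T t)"
        using fwd_jump_mem[OF T(1) t] fwd_jump_ge[of t T] a by (intro FG) auto
      then show "\<exists>r>0. \<forall>s\<in>T. \<bar>s - t\<bar> < r \<longrightarrow>
          norm (F (fwd_jump T t) - F s - (fwd_jump T t - s) *\<^sub>R d) \<le> e * \<bar>fwd_jump T t - s\<bar>"
        using r \<delta> FG by (intro exI[of _ "min r \<delta>"]) auto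
    qed
    have sig: "fwd_jump T t \<in> T" "a \<le> fwd_jump T t"
      using fwd_jump_mem[OF T(1) t] fwd_jump_ge[of t T] a by auto
    have Pa: "has_delta_derivative (T \<inter> {a..}) (fst (P a)) (A t ** X t) t"
      "has_delta_derivative (T \<inter> {a..}) (snd (P a)) (- (Z (fwd_jump T t) ** A t)) t"
      "Z t ** X t = mat 1"
      using P(1)[OF a(1,3)] t a XZ[OF a(1,3,2) t] XZ[OF a(1,3) sig(2,1)]
      by (auto simp: fundamental_pair_def fwd_jump_Int_atLeast)
    show "has_delta_derivative T X (A t ** X t) t \<and>
      has_delta_derivative T Z (- (Z (fwd_jump T t) ** A t)) t \<and> Z t ** X t = mat 1"
      using local[OF Pa(1), of X] local[OF Pa(2), of Z] XZ[OF a(1,3)] Pa(3) by auto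
  qed
  then show thesis by (rule that)
qed

section \<open>Real powers of a complex matrix\<close>

lemma mat_mult_nth [simp]: "(mat c ** X) $ i $ j = (c :: 'a::comm_semiring_1) * X $ i $ j"
  by (simp add: matrix_matrix_mult_def mat_def if_distrib[of "\<lambda>x. x * _"] cong: if_cong)

lemma mult_mat_nth [simp]: "(X ** mat c) $ i $ j = (c :: 'a::comm_semiring_1) * X $ i $ j"
  by (simp add: matrix_matrix_mult_def mat_def if_distrib[of "\<lambda>x. _ * x"] mult.commute cong: if_cong)

lemma mat_add: "mat (a + b) = mat a + mat (b :: 'a::comm_semiring_1)"
  by (simp add: vec_eq_iff mat_def)

lemma mat_commute: "X ** mat c = mat c ** (X :: 'a::comm_semiring_1^'n^'m)"
  by (simp add: vec_eq_iff)

lemma mat_mult_assoc_left: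
  fixes X :: "'a::comm_semiring_1^'n^'m"
  shows "mat c ** (X ** Y) = X ** (mat c ** Y)"
  by (simp only: matrix_mul_assoc mat_commute[of X c])

lemma mat_mult_mat: "mat a ** mat b = mat (a * b :: 'a::comm_semiring_1)"
  by (simp add: vec_eq_iff) (simp add: mat_def mult.commute)

lemma mat_of_real_mult: "mat (of_real r) ** X = r *\<^sub>R (X :: complex^'n^'m)"
  by (simp add: vec_eq_iff scaleR_conv_of_real[where 'a = complex])

lemma mat_0: "mat 0 = 0"
  by (simp add: vec_eq_iff mat_def)

text \<open>Horner evaluation at \<open>M\<close>, with scalars embedded as \<open>mat a\<close> and
  \<open>**\<close> as the product; the lemmas below show that it is an algebra
  homomorphism.\<close>

definition poly_mat :: "complex^'n^'n \<Rightarrow> complex poly \<Rightarrow> complex^'n^'n" where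
  "poly_mat M p = fold_coeffs (\<lambda>a X. mat a + M ** X) p 0"

lemma poly_mat_0 [simp]: "poly_mat M 0 = 0"
  by (simp add: poly_mat_def)

lemma poly_mat_pCons [simp]: "poly_mat M (pCons a p) = mat a + M ** poly_mat M p"
  by (cases "p = 0 \<and> a = 0") (auto simp: poly_mat_def mat_0 matrix_mult_zero_right)

lemma poly_mat_1 [simp]: "poly_mat M 1 = mat 1"
  by (simp add: one_pCons matrix_mult_zero_right)

lemma poly_mat_add: "poly_mat M (p + q) = poly_mat M p + poly_mat M q"
  by (induction p q rule: poly_induct2) (simp_all add: mat_add matrix_mult_add_right)

lemma poly_mat_smult: "poly_mat M (smult c p) = mat c ** poly_mat M p"
  by (induction p) (simp_all add: matrix_mult_zero_right matrix_mult_add_right mat_mult_assoc_left mat_mult_mat)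

lemma poly_mat_diff: "poly_mat M (p - q) = poly_mat M p - poly_mat M q"
proof -
  have "poly_mat M (p - q) + poly_mat M q = poly_mat M p"
    by (simp flip: poly_mat_add)
  then show ?thesis by (simp add: eq_diff_eq)
qed

lemma poly_mat_mult: "poly_mat M (p * q) = poly_mat M p ** poly_mat M q"
proof (induction p)
  case (pCons a p)
  have "poly_mat M (pCons a p * q) = mat a ** poly_mat M q + M ** (poly_mat M p ** poly_mat M q)"
    by (simp add: poly_mat_add poly_mat_smult mat_0 pCons.IH)
  also have "\<dots> = poly_mat M (pCons a p) ** poly_mat M q"
    by (simp add: matrix_mult_add_left) (rule matrix_mul_assoc)
  finally show ?case .
qed (simp add: matrix_mult_zero_left)

lemma poly_mat_sum: "poly_mat M (sum f S) = (\<Sum>x\<in>S. poly_mat M (f x))"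
  by (induction S rule: infinite_finite_induct) (simp_all add: poly_mat_add)

lemma poly_mat_eq_0_dvd: "q dvd p \<Longrightarrow> poly_mat M q = 0 \<Longrightarrow> poly_mat M p = 0"
  by (auto simp: dvd_def poly_mat_mult matrix_mult_zero_left)

lemma smult_sum_right: "smult c (sum f S) = (\<Sum>x\<in>S. smult c (f x))"
  by (induction S rule: infinite_finite_induct) (simp_all add: smult_add_right)

text \<open>The powers of \<open>M\<close> lie in a finite-dimensional real space. Either two of
  them coincide, or more of them than the dimension are distinct and hence dependent; real
  coefficients are enough.\<close>

lemma annihilating_poly_exists:
  fixes M :: "complex^'n^'n"
  obtains q where "q \<noteq> 0" "poly_mat M q = 0"
proof (cases "inj (\<lambda>i. poly_mat M (monom 1 i))")
  case False
  then obtain i j where ij: "i \<noteq> j" "poly_mat M (monom 1 i) = poly_mat M (monom 1 j)"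
    by (auto simp: inj_def)
  have "monom 1 i - monom 1 j \<noteq> (0 :: complex poly)"
    using ij(1) by (metis coeff_monom diff_eq_diff_eq diff_self one_neq_zero)
  then show thesis using ij(2) by (intro that[of "monom 1 i - monom 1 j"]) (auto simp: poly_mat_diff)
next
  case True
  define f where "f i = poly_mat M (monom 1 i)" for i
  define D where "D = DIM(complex^'n^'n)"
  have inj: "inj_on f {..D}" using True inj_on_subset unfolding f_def by blast
  then have "card (f ` {..D}) > DIM(complex^'n^'n)" by (simp add: card_image D_def)
  then have "dependent (f ` {..D})" by (intro dependent_biggerset)
  then obtain u where u: "\<exists>v\<in>f ` {..D}. u v \<noteq> 0" "(\<Sum>v\<in>f ` {..D}. u v *\<^sub>R v) = 0"
    using real_vector.dependent_finite[of "f ` {..D}"] by auto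
  define q where "q = (\<Sum>i\<le>D. monom (complex_of_real (u (f i))) i)"
  have coeff: "coeff q i = complex_of_real (u (f i))" if "i \<le> D" for i
    using that by (simp add: q_def coeff_sum)
  have "q \<noteq> 0" using u(1) coeff by (metis (no_types, lifting) atMost_iff coeff_0 imageE of_real_eq_0_iff)
  moreover have "poly_mat M q = 0"
  proof -
    have "poly_mat M (monom (complex_of_real r) i) = r *\<^sub>R f i" for r i
      using poly_mat_smult[of M "complex_of_real r" "monom 1 i"]
      by (simp add: smult_monom f_def mat_of_real_mult)
    then have "poly_mat M q = (\<Sum>i\<le>D. u (f i) *\<^sub>R f i)" by (simp add: q_def poly_mat_sum)
    also have "\<dots> = 0" using u(2) by (simp add: sum.reindex[OF inj])
    finally show ?thesis .
  qed
  ultimately show thesis by (rule that)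
qed

section \<open>Coprime linear factors, Chinese remaindering and truncated series\<close>

lemma coprime_linear_poly:
  fixes p :: "complex poly"
  assumes "poly p z \<noteq> 0"
  shows "coprime p [:-z, 1:]"
proof (rule coprimeI)
  fix d assume d: "d dvd p" "d dvd [:-z, 1:]"
  have "[:-z, 1:] dvd p - [:poly p z:]" by (simp flip: poly_eq_0_iff_dvd)
  then have "d dvd p - (p - [:poly p z:])" using d by (metis dvd_diff dvd_trans)
  then have "d dvd [:poly p z:]" by simp
  moreover have "is_unit [:poly p z:]" using assms by (simp add: is_unit_const_poly_iff dvd_field_iff)
  ultimately show "is_unit d" by (rule dvd_trans)
qed

lemma prod_linear_power_dvd:
  fixes p :: "complex poly"
  assumes "finite Z" "\<And>z. z \<in> Z \<Longrightarrow> [:-z, 1:] ^ K dvd p"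
  shows "(\<Prod>z\<in>Z. [:-z, 1:] ^ K) dvd p"
  using assms
proof (induction Z rule: finite_induct)
  case (insert z Z)
  have "coprime ([:-z, 1:] ^ K) (\<Prod>z\<in>Z. [:-z, 1:] ^ K)"
    using insert(2) by (intro prod_coprime_right)
      (auto simp: coprime_power_right_iff coprime_power_left_iff intro!: coprime_linear_poly)
  then show ?case using insert by (auto intro!: divides_mult)
qed simp

text \<open>Each \<open>P z\<close> is a Bezout multiple of the product of the other factors. At
  \<open>M\<close> these become the projections onto the generalised eigenspaces, here handled as
  polynomials only.\<close>

lemma crt_idempotents:
  fixes Z :: "complex set"
  assumes "finite Z"
  obtains P :: "complex \<Rightarrow> complex poly" where
    "\<And>z. z \<in> Z \<Longrightarrow> [:-z, 1:] ^ K dvd P z - 1"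
    "\<And>z z'. z \<in> Z \<Longrightarrow> z' \<in> Z \<Longrightarrow> z' \<noteq> z \<Longrightarrow> [:-z', 1:] ^ K dvd P z"
proof -
  have "\<exists>p. [:-z, 1:] ^ K dvd p - 1 \<and> (\<forall>z'\<in>Z. z' \<noteq> z \<longrightarrow> [:-z', 1:] ^ K dvd p)" if "z \<in> Z" for z
  proof -
    define c where "c = (\<Prod>z'\<in>Z - {z}. [:-z', 1:] ^ K)"
    have "coprime ([:-z, 1:] ^ K) c"
      unfolding c_def by (intro prod_coprime_right)
        (auto simp: coprime_power_right_iff coprime_power_left_iff intro!: coprime_linear_poly)
    then obtain a b where ab: "a * c + b * [:-z, 1:] ^ K = 1"
      using bezout_coefficients_fst_snd[of c "[:-z, 1:] ^ K"]
      by (metis coprime_commute coprime_imp_gcd_eq_1)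
    have "a * c - 1 = - (b * [:-z, 1:] ^ K)" using ab by (simp add: algebra_simps flip: ab)
    then have "[:-z, 1:] ^ K dvd a * c - 1" by simp
    moreover have "[:-z', 1:] ^ K dvd a * c" if "z' \<in> Z" "z' \<noteq> z" for z'
      unfolding c_def using that assms by (intro dvd_mult dvd_prodI) auto
    ultimately show ?thesis by blast
  qed
  then show thesis using that by metis
qed

lemma invertible_annihilating_poly:
  fixes M :: "complex^'n^'n"
  assumes "invertible M"
  obtains Z K where "finite Z" "0 \<notin> Z" "K \<ge> 2" "poly_mat M (\<Prod>z\<in>Z. [:-z, 1:] ^ K) = 0"
proof -
  obtain q where q: "q \<noteq> 0" "poly_mat M q = 0" by (rule annihilating_poly_exists)
  define Z where "Z = {z. poly q z = 0}"
  define K where "K = degree q + 2"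
  define Q where "Q = (\<Prod>z\<in>Z - {0}. [:-z, 1:] ^ K)"
  have fin: "finite Z" unfolding Z_def using q(1) by (rule poly_roots_finite)
  have "(\<Prod>z\<in>Z. [:-z, 1:] ^ order z q) dvd (\<Prod>z\<in>Z. [:-z, 1:] ^ K)"
    using order_degree[OF q(1)] by (intro prod_dvd_prod le_imp_power_dvd) (auto simp: K_def intro: le_SucI)
  then have "q dvd (\<Prod>z\<in>Z. [:-z, 1:] ^ K)"
    using q(1) by (subst complex_poly_decompose[of q, symmetric]) (simp add: Z_def smult_dvd)
  also have "(\<Prod>z\<in>Z. [:-z, 1:] ^ K) dvd [:0, 1:] ^ K * Q"
    using fin by (cases "0 \<in> Z") (auto simp: Q_def prod.remove)
  finally have "poly_mat M ([:0, 1:] ^ K) ** poly_mat M Q = 0"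
    using q(2) by (simp add: poly_mat_eq_0_dvd flip: poly_mat_mult)
  moreover have "invertible (poly_mat M ([:0, 1:] ^ k))" for k
  proof (induction k)
    case (Suc k)
    have "poly_mat M ([:0, 1:] ^ Suc k) = M ** poly_mat M ([:0, 1:] ^ k)"
      by (simp add: mat_0)
    then show ?case using Suc assms by (simp add: invertible_mult)
  qed (simp add: invertible_mat_1)
  then have "matrix_inv (poly_mat M ([:0, 1:] ^ K)) ** poly_mat M ([:0, 1:] ^ K) = mat 1"
    by (rule invertible_matrix_inv)
  ultimately have "poly_mat M Q = 0"
    by (metis matrix_mul_assoc matrix_mul_lid matrix_mult_zero_right)
  with fin show thesis by (intro that[of "Z - {0}" K]) (auto simp: Q_def K_def)
qed

text \<open>The difference consists of the products whose exponents add up to at least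
  \<open>K\<close>. This carries the addition law of binomial series over to their
  truncations.\<close>

lemma truncated_mult_dvd:
  fixes y :: "'a::comm_ring_1"
  shows "y ^ K dvd (\<Sum>i<K. a i * y ^ i) * (\<Sum>j<K. b j * y ^ j)
    - (\<Sum>k<K. (\<Sum>i\<le>k. a i * b (k - i)) * y ^ k)"
proof -
  define g where "g = (\<lambda>(i, j). a i * y ^ i * (b j * y ^ j))"
  define S where "S = {..<K} \<times> {..<K}"
  define S1 where "S1 = {(i, j). i + j < K}"
  have S: "finite S" "S1 \<subseteq> S" by (auto simp: S_def S1_def)
  have "(\<Sum>i<K. a i * y ^ i) * (\<Sum>j<K. b j * y ^ j) = sum g S"
    by (simp add: sum_product sum.cartesian_product g_def S_def case_prod_unfold)
  also have "\<dots> = sum g S1 + sum g (S - S1)"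
    using S by (metis sum.subset_diff add.commute)
  also have "sum g S1 = (\<Sum>k<K. \<Sum>i\<le>k. a i * y ^ i * (b (k - i) * y ^ (k - i)))"
    unfolding g_def S1_def by (rule sum.triangle_reindex)
  also have "\<dots> = (\<Sum>k<K. (\<Sum>i\<le>k. a i * b (k - i)) * y ^ k)"
  proof (intro sum.cong refl)
    fix k
    have "a i * y ^ i * (b (k - i) * y ^ (k - i)) = a i * b (k - i) * y ^ k" if "i \<le> k" for i
    proof -
      have "y ^ k = y ^ i * y ^ (k - i)" using that by (simp flip: power_add)
      then show ?thesis by (simp add: algebra_simps)
    qed
    then show "(\<Sum>i\<le>k. a i * y ^ i * (b (k - i) * y ^ (k - i))) = (\<Sum>i\<le>k. a i * b (k - i)) * y ^ k"
      by (simp add: sum_distrib_right)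
  qed
  finally have "(\<Sum>i<K. a i * y ^ i) * (\<Sum>j<K. b j * y ^ j)
    - (\<Sum>k<K. (\<Sum>i\<le>k. a i * b (k - i)) * y ^ k) = sum g (S - S1)" by simp
  also have "y ^ K dvd \<dots>"
  proof (rule dvd_sum)
    fix x assume "x \<in> S - S1"
    then obtain i j where x: "x = (i, j)" "K \<le> i + j" by (force simp: S1_def)
    have "g x = a i * b j * y ^ (i + j)" by (simp add: g_def x power_add algebra_simps)
    then show "y ^ K dvd g x" using x by (simp add: le_imp_power_dvd dvd_mult)
  qed
  finally show ?thesis .
qed

text \<open>The branch with argument in \<open>{0<..2 * pi}\<close> keeps \<open>exp (s * w) \<noteq> 1\<close> for \<open>0 < s < 1\<close>.\<close>

lemma logarithm_branch:
  fixes z :: complex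
  assumes "z \<noteq> 0"
  obtains w where "exp w = z" "\<And>s. 0 < s \<Longrightarrow> s < 1 \<Longrightarrow> exp (complex_of_real s * w) \<noteq> 1"
proof -
  \<comment> \<open>The principal logarithm has imaginary part in \<open>{-pi<..pi}\<close>; adding
    one period to the nonpositive values gives \<open>{0<..2 * pi}\<close>.\<close>
  define w where "w = (if 0 < Im (Ln z) then Ln z else Ln z + 2 * of_real pi * \<i>)"
  have w: "exp w = z" using assms by (simp add: w_def exp_add)
  have im: "0 < Im w" "Im w \<le> 2 * pi"
    using Im_Ln_le_pi[OF assms] mpi_less_Im_Ln[OF assms] by (auto simp: w_def)
  have "exp (complex_of_real s * w) \<noteq> 1" if s: "0 < s" "s < 1" for s
  proof
    assume "exp (complex_of_real s * w) = 1"
    then obtain n :: int where "s * Im w = of_int (2 * n) * pi"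
      by (auto simp: exp_eq_1)
    moreover have "0 < s * Im w" using s im by simp
    moreover have "s * Im w < 2 * pi"
      using mult_strict_right_mono[of s 1 "Im w"] s im by linarith
    ultimately have "0 < real_of_int n" "real_of_int n < 1" by (simp_all add: zero_less_mult_iff)
    then have "0 < n" "n < 1" by simp_all
    then show False by simp
  qed
  with w show thesis by (rule that)
qed

text \<open>\<open>E s\<close> is the polynomial \<open>e s\<close> at \<open>M\<close>, where
  \<open>e s\<close> represents a branch of \<open>x\<close> to the power \<open>s\<close> modulo
  each \<open>[:-z, 1:] ^ K\<close>. Group law, normalisation and invertibility are checked modulo
  these factors.\<close>

lemma matrix_real_powers:
  fixes M :: "complex^'n^'n"
  assumes M: "invertible M"
  obtains E W where "E 0 = mat 1" "E 1 = M" "\<And>s t. E (s + t) = E s ** E t"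
    "\<And>s. (E has_vector_derivative W ** E s) (at s)"
    "\<And>s. W ** E s = E s ** W"
    "\<And>s. 0 < s \<Longrightarrow> s < 1 \<Longrightarrow> invertible (E s - mat 1)" "invertible W"
proof -
  obtain Z K where Z: "finite Z" "0 \<notin> Z" and K: "K \<ge> 2"
    and ann: "poly_mat M (\<Prod>z\<in>Z. [:-z, 1:] ^ K) = 0"
    using invertible_annihilating_poly[OF M] by blast
  obtain P :: "complex \<Rightarrow> complex poly" where
    P1: "\<And>z. z \<in> Z \<Longrightarrow> [:-z, 1:] ^ K dvd P z - 1" and
    P0: "\<And>z z'. z \<in> Z \<Longrightarrow> z' \<in> Z \<Longrightarrow> z' \<noteq> z \<Longrightarrow> [:-z', 1:] ^ K dvd P z"
    using crt_idempotents[OF Z(1)] by metis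
  have "\<exists>w. exp w = z \<and> (\<forall>s. 0 < s \<longrightarrow> s < 1 \<longrightarrow> exp (complex_of_real s * w) \<noteq> 1)" if "z \<in> Z" for z
    using logarithm_branch[of z] Z(2) that by metis
  then obtain w where w: "\<And>z. z \<in> Z \<Longrightarrow> exp (w z) = z"
    "\<And>z s. z \<in> Z \<Longrightarrow> 0 < s \<Longrightarrow> s < 1 \<Longrightarrow> exp (complex_of_real s * w z) \<noteq> 1"
    by metis
  define y where "y z = [:-1, 1 / z:]" for z :: complex
  \<comment> \<open>As \<open>x = z (1 + y z)\<close>, this is the power of \<open>x\<close> at the
    root \<open>z\<close>: the chosen branch of the power of \<open>z\<close>, times the binomial
    series of \<open>1 + y z\<close>. The series may stop at \<open>K\<close> because
    \<open>y z ^ K\<close> is divisible by the modulus.\<close>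
  define b where "b z s = smult (exp (of_real s * w z)) (\<Sum>k<K. smult (of_real s gchoose k) (y z ^ k))"
    for z and s :: real
  define e where "e s = (\<Sum>z\<in>Z. P z * b z s)" for s
  define E where "E s = poly_mat M (e s)" for s
  have e_b: "[:-z, 1:] ^ K dvd e s - b z s" if z: "z \<in> Z" for z s
  proof -
    have "e s - b z s = (P z - 1) * b z s + (\<Sum>z'\<in>Z - {z}. P z' * b z' s)"
      using Z(1) z by (simp add: e_def sum.remove algebra_simps)
    also have "[:-z, 1:] ^ K dvd \<dots>"
      using P1[OF z] P0[OF _ z] by (intro dvd_add dvd_sum dvd_mult2) auto
    finally show ?thesis .
  qed
  have y: "[:-z, 1:] ^ K dvd y z ^ K" if z: "z \<in> Z" for z
  proof -
    have "y z = smult (1 / z) [:-z, 1:]" using z Z(2) by (auto simp: y_def)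
    then have "y z ^ K = smult ((1 / z) ^ K) ([:-z, 1:] ^ K)" by (simp only: smult_power)
    then show ?thesis by (simp only: dvd_smult dvd_refl)
  qed
  \<comment> \<open>Vandermonde's identity for generalised binomial coefficients is the addition law
    of the full series, and truncation only changes multiples of \<open>y z ^ K\<close>.\<close>
  have b_add: "[:-z, 1:] ^ K dvd b z s * b z t - b z (s + t)" if z: "z \<in> Z" for z s t
  proof -
    define B where "B s = (\<Sum>k<K. [:complex_of_real s gchoose k:] * y z ^ k)" for s :: real
    have b_B: "b z s = smult (exp (of_real s * w z)) (B s)" for s by (simp add: b_def B_def)
    have "(\<Sum>i\<le>k. [:complex_of_real s gchoose i:] * [:complex_of_real t gchoose (k - i):]) = [:complex_of_real (s + t) gchoose k:]"
      for k
    proof -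
      have "(\<Sum>i\<le>k. [:complex_of_real s gchoose i:] * [:complex_of_real t gchoose (k - i):])
        = [:\<Sum>i\<le>k. (complex_of_real s gchoose i) * (complex_of_real t gchoose (k - i)):]"
        by (simp add: mult.commute flip: sum_to_poly)
      also have "(\<Sum>i\<le>k. (complex_of_real s gchoose i) * (complex_of_real t gchoose (k - i))) = ((of_real (s + t) :: complex) gchoose k)"
        using gbinomial_Vandermonde[of "of_real s :: complex" "of_real t" k] by (simp add: atLeast0AtMost)
      finally show ?thesis .
    qed
    then have "y z ^ K dvd B s * B t - B (s + t)"
      using truncated_mult_dvd[of "y z" K "\<lambda>k. [:complex_of_real s gchoose k:]" "\<lambda>k. [:complex_of_real t gchoose k:]"]
      by (simp only: B_def)
    then have "[:-z, 1:] ^ K dvd B s * B t - B (s + t)" using y[OF z] dvd_trans by blast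
    then have "[:-z, 1:] ^ K dvd smult (exp (of_real (s + t) * w z)) (B s * B t - B (s + t))"
      by (rule dvd_smult)
    also have "smult (exp (of_real (s + t) * w z)) (B s * B t - B (s + t)) = b z s * b z t - b z (s + t)"
      by (simp add: b_B smult_diff_right exp_add[symmetric] algebra_simps)
    finally show ?thesis .
  qed
  \<comment> \<open>Congruence modulo each coprime factor gives congruence modulo their product,
    which annihilates \<open>M\<close>.\<close>
  have Q: "poly_mat M f = poly_mat M g" if "\<And>z. z \<in> Z \<Longrightarrow> [:-z, 1:] ^ K dvd f - g" for f g
    using poly_mat_eq_0_dvd[OF prod_linear_power_dvd[OF Z(1) that] ann] by (simp add: poly_mat_diff)
  have E_add: "E (s + t) = E s ** E t" for s t
  proof -
    have "poly_mat M (e s * e t) = poly_mat M (e (s + t))"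
    proof (rule Q)
      fix z assume z: "z \<in> Z"
      have "e s * e t - e (s + t) = e s * (e t - b z t) + (e s - b z s) * b z t
        + (b z s * b z t - b z (s + t)) - (e (s + t) - b z (s + t))"
        by (simp add: algebra_simps)
      also have "[:-z, 1:] ^ K dvd \<dots>"
        by (intro e_b[OF z] b_add[OF z] dvd_mult[OF e_b[OF z]] dvd_mult2[OF e_b[OF z]] dvd_add dvd_diff)
      finally show "[:-z, 1:] ^ K dvd e s * e t - e (s + t)" .
    qed
    then show ?thesis by (simp add: E_def poly_mat_mult)
  qed
  have E_0: "E 0 = mat 1"
  proof -
    have "b z 0 = 1" for z
    proof -
      have "(\<Sum>k<K. smult (of_real 0 gchoose k) (y z ^ k)) = (\<Sum>k<K. if k = 0 then 1 else 0)"
        by (intro sum.cong) (auto simp: gbinomial_0_left)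
      then show ?thesis using K by (simp add: b_def)
    qed
    then have "poly_mat M (e 0) = poly_mat M 1" using e_b[of _ 0] by (intro Q) auto
    then show ?thesis by (simp add: E_def)
  qed
  have E_1: "E 1 = M"
  proof -
    have "b z 1 = [:0, 1:]" if z: "z \<in> Z" for z
    proof -
      \<comment> \<open>For \<open>s = 1\<close> only the terms \<open>k = 0, 1\<close> survive,
        both present as \<open>K \<ge> 2\<close>, and \<open>z (1 + y z)\<close> is the polynomial
        \<open>x\<close>.\<close>
      have one: "(1 :: complex) gchoose k = (if k \<le> 1 then 1 else 0)" for k
        using binomial_gbinomial[of 1 k, where 'a = complex] by (cases k) (auto simp: binomial_eq_0)
      have "(\<Sum>k<K. smult (of_real 1 gchoose k) (y z ^ k)) = (\<Sum>k\<in>{0, 1}. y z ^ k)"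
        using K by (intro sum.mono_neutral_cong_right) (auto simp: one)
      also have "\<dots> = 1 + y z" by simp
      finally show ?thesis using w(1)[OF z] z Z(2) by (auto simp: b_def y_def one_pCons)
    qed
    then have "poly_mat M (e 1) = poly_mat M [:0, 1:]" using e_b[of _ 1] by (intro Q) metis
    then show ?thesis by (simp add: E_def mat_0 matrix_mult_zero_right)
  qed
  \<comment> \<open>At a root \<open>z\<close> the polynomial \<open>e s\<close> takes the value
    \<open>exp (s * w z)\<close>, which is not \<open>1\<close>. So \<open>e s - 1\<close> is
    coprime to the annihilating product, and its Bezout cofactor evaluates to an inverse.\<close>
  have E_inv: "invertible (E s - mat 1)" if s: "0 < s" "s < 1" for s
  proof -
    define Q where "Q = (\<Prod>z\<in>Z. [:-z, 1:] ^ K)"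
    have "coprime (e s - 1) [:-z, 1:]" if z: "z \<in> Z" for z
    proof (rule coprime_linear_poly)
      have "[:-z, 1:] dvd [:-z, 1:] ^ K" using K by (intro dvd_power) auto
      then have "[:-z, 1:] dvd e s - b z s" using e_b[OF z] dvd_trans by blast
      then have "poly (e s) z = poly (b z s) z" by (simp flip: poly_eq_0_iff_dvd)
      also have "poly (y z) z = 0" using z Z(2) by (auto simp: y_def)
      then have "poly (b z s) z = exp (of_real s * w z) * (\<Sum>k<K. (of_real s gchoose k) * 0 ^ k)"
        by (simp add: b_def poly_sum)
      also have "(\<Sum>k<K. ((of_real s :: complex) gchoose k) * 0 ^ k) = (\<Sum>k<K. if k = 0 then 1 else 0)"
        by (intro sum.cong) auto
      also have "\<dots> = 1" using K by simp
      finally show "poly (e s - 1) z \<noteq> 0" using w(2)[OF z s] by simp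
    qed
    then have "coprime (e s - 1) Q" unfolding Q_def
      by (intro prod_coprime_right) (auto simp: coprime_power_right_iff)
    then obtain c d where "c * (e s - 1) + d * Q = 1"
      using bezout_coefficients_fst_snd[of "e s - 1" Q] by (metis coprime_imp_gcd_eq_1)
    then have "poly_mat M (c * (e s - 1) + d * Q) = mat 1" by simp
    then have "poly_mat M c ** (E s - mat 1) = mat 1"
      using ann by (simp add: poly_mat_add poly_mat_mult poly_mat_diff E_def Q_def matrix_mult_zero_right)
    then show ?thesis using invertible_left_inverse by blast
  qed
  \<comment> \<open>In \<open>E s\<close> only the scalar coefficients depend on \<open>s\<close>;
    they are holomorphic, and the matrices are fixed. Differentiability at \<open>0\<close> is
    enough, the group law moves it elsewhere.\<close>
  obtain W where W: "(E has_vector_derivative W) (at 0)"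
  proof -
    define g where "g z k x = exp (x * w z) * (x gchoose k)" for z k and x :: complex
    have "b z s = (\<Sum>k<K. smult (g z k (of_real s)) (y z ^ k))" for z s
      by (simp add: b_def g_def smult_sum_right)
    then have E_sum: "E s = (\<Sum>z\<in>Z. \<Sum>k<K. mat (g z k (of_real s)) ** poly_mat M (P z * y z ^ k))" for s
      by (simp add: E_def e_def poly_mat_sum sum_distrib_left poly_mat_smult)
    have "((\<lambda>s. mat (g z k (of_real s)) ** X) has_vector_derivative mat (deriv (g z k) 0) ** X) (at 0)"
      for z k and X :: "complex^'n^'n"
    proof -
      have "g z k holomorphic_on UNIV"
        unfolding g_def gbinomial_prod_rev by (intro holomorphic_intros) auto
      then have "(g z k has_field_derivative deriv (g z k) 0) (at (of_real 0))"
        by (simp add: holomorphic_derivI)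
      then have "((\<lambda>s. g z k (of_real s)) has_vector_derivative deriv (g z k) 0) (at 0)"
        by (rule has_vector_derivative_real_field)
      moreover have "bounded_linear (\<lambda>c. mat c ** X)"
        by (intro linear_conv_bounded_linear[THEN iffD1] linearI)
           (simp_all add: vec_eq_iff distrib_right)
      ultimately show ?thesis using bounded_linear.has_vector_derivative by blast
    qed
    then have "((\<lambda>s. \<Sum>z\<in>Z. \<Sum>k<K. mat (g z k (of_real s)) ** poly_mat M (P z * y z ^ k))
      has_vector_derivative (\<Sum>z\<in>Z. \<Sum>k<K. mat (deriv (g z k) 0) ** poly_mat M (P z * y z ^ k))) (at 0)"
      by (intro has_vector_derivative_sum)
    then have "(E has_vector_derivative
      (\<Sum>z\<in>Z. \<Sum>k<K. mat (deriv (g z k) 0) ** poly_mat M (P z * y z ^ k))) (at 0)"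
      by (simp flip: E_sum)
    then show thesis by (rule that)
  qed
  \<comment> \<open>Splitting \<open>E u\<close> as \<open>E (u - s) ** E s\<close> or as
    \<open>E s ** E (u - s)\<close> gives both forms of the derivative, and their equality is the
    commutation with \<open>W\<close>.\<close>
  have E_deriv: "(E has_vector_derivative W ** E s) (at s)" "(E has_vector_derivative E s ** W) (at s)" for s
  proof -
    have "((\<lambda>u. u - s) has_vector_derivative 1) (at s)"
      by (auto intro!: derivative_eq_intros)
    then have D: "((\<lambda>u. E (u - s)) has_vector_derivative W) (at s)"
      using vector_diff_chain_at[of "\<lambda>u. u - s" 1 s E W] W by (simp add: o_def)
    have "((\<lambda>u. E (u - s) ** E s) has_vector_derivative W ** E s) (at s)"
      by (rule bounded_linear.has_vector_derivative[OF
            bounded_bilinear.bounded_linear_left[OF bounded_bilinear_matrix_mult] D])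
    then show "(E has_vector_derivative W ** E s) (at s)" by (simp flip: E_add)
    have "((\<lambda>u. E s ** E (u - s)) has_vector_derivative E s ** W) (at s)"
      by (rule bounded_linear.has_vector_derivative[OF
            bounded_bilinear.bounded_linear_right[OF bounded_bilinear_matrix_mult] D])
    then show "(E has_vector_derivative E s ** W) (at s)" by (simp flip: E_add)
  qed
  then have W_comm: "W ** E s = E s ** W" for s
    by (rule vector_derivative_unique_at)
  \<comment> \<open>If \<open>W\<close> kills \<open>v\<close>, then \<open>E s *v v\<close> is
    constant in \<open>s\<close>, so \<open>E (1/2) - mat 1\<close> kills \<open>v\<close> too; any
    parameter strictly between \<open>0\<close> and \<open>1\<close> would do.\<close>
  have "invertible W"
  proof (rule ccontr)
    assume "\<not> invertible W"
    then obtain v where v: "v \<noteq> 0" "W *v v = 0"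
      using invertible_left_inverse[of W] matrix_left_invertible_ker[of W] by blast
    have "linear (\<lambda>X :: complex^'n^'n. X *v v)"
      by (intro linearI) (simp_all add: vec_eq_iff matrix_vector_mult_def distrib_right sum.distrib scaleR_sum_right)
    then have "bounded_linear (\<lambda>X :: complex^'n^'n. X *v v)" by (simp add: linear_conv_bounded_linear)
    then have "((\<lambda>s. E s *v v) has_vector_derivative (E s ** W) *v v) (at s)" for s
      using E_deriv(2) by (rule bounded_linear.has_vector_derivative)
    then have D0: "((\<lambda>s. E s *v v) has_vector_derivative 0) (at s within UNIV)" for s
      using v(2) by (simp flip: matrix_vector_mul_assoc)
    obtain c where c: "\<And>s. s \<in> UNIV \<Longrightarrow> E s *v v = c"
      using has_vector_derivative_zero_constant[OF convex_UNIV D0] by blast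
    have "(E (1/2) - mat 1) *v v = 0"
      using c[of "1/2"] c[of 0] by (simp add: matrix_vector_mult_diff_rdistrib E_0)
    moreover have "invertible (E (1/2) - mat 1)" by (rule E_inv) auto
    ultimately show False
      using v(1) invertible_left_inverse[of "E (1/2) - mat 1"] matrix_left_invertible_ker[of "E (1/2) - mat 1"]
      by blast
  qed
  with E_0 E_1 E_add E_deriv(1) W_comm E_inv show thesis by (rule that)
qed

section \<open>The Floquet decomposition\<close>

lemma has_vector_derivative_imp_quotient_tendsto:
  assumes "(f has_vector_derivative d) (at x within S)"
  shows "((\<lambda>y. (1 / (y - x)) *\<^sub>R (f y - f x)) \<longlongrightarrow> d) (at x within S)"
proof -
  have "((\<lambda>y. norm (f y - f x - (y - x) *\<^sub>R d) / norm (y - x)) \<longlongrightarrow> 0) (at x within S)"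
    using assms by (simp add: has_vector_derivative_def has_derivative_iff_norm)
  then have "((\<lambda>y. norm ((1 / (y - x)) *\<^sub>R (f y - f x) - d)) \<longlongrightarrow> 0) (at x within S)"
  proof (rule Lim_transform_eventually)
    have "norm (f y - f x - (y - x) *\<^sub>R d) / norm (y - x) = norm ((1 / (y - x)) *\<^sub>R (f y - f x) - d)"
      if "y \<noteq> x" for y
    proof -
      have "(1 / (y - x)) *\<^sub>R (f y - f x) - d = (1 / (y - x)) *\<^sub>R (f y - f x - (y - x) *\<^sub>R d)"
        using that by (simp add: scaleR_diff_right)
      then show ?thesis by (simp add: divide_inverse)
    qed
    then show "\<forall>\<^sub>F y in at x within S. norm (f y - f x - (y - x) *\<^sub>R d) / norm (y - x)
        = norm ((1 / (y - x)) *\<^sub>R (f y - f x) - d)"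
      by (simp add: eventually_at_filter)
  qed
  then show ?thesis by (rule LIM_zero_cancel[OF tendsto_norm_zero_cancel])
qed

lemma (in bounded_linear) rd_continuous:
  "rd_continuous T g \<Longrightarrow> rd_continuous T (\<lambda>t. f (g t))"
  by (fastforce simp: rd_continuous_def intro: continuous tendsto)

lemma has_delta_derivative_diff:
  assumes "t \<in> T" "has_delta_derivative T f d t" "has_delta_derivative T g e t"
  shows "has_delta_derivative T (\<lambda>s. f s - g s) (d - e) t"
  using assms by (auto simp: has_delta_derivative_iff algebra_simps split: if_splits
      intro!: has_vector_derivative_diff continuous_diff)

lemma has_delta_derivative_shift:
  assumes "\<And>s. s \<in> T \<Longrightarrow> s + p \<in> T" "fwd_jump T (t + p) = fwd_jump T t + p"
    "has_delta_derivative T F d (t + p)"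
  shows "has_delta_derivative T (\<lambda>s. F (s + p)) d t"
  unfolding has_delta_derivative_def
proof (intro allI impI)
  fix e :: real assume "e > 0"
  then obtain \<delta> where \<delta>: "\<delta> > 0" "\<And>s. s \<in> T \<Longrightarrow> \<bar>s - (t + p)\<bar> < \<delta> \<Longrightarrow>
      norm (F (fwd_jump T t + p) - F s - (fwd_jump T t + p - s) *\<^sub>R d) \<le> e * \<bar>fwd_jump T t + p - s\<bar>"
    using assms(3) unfolding has_delta_derivative_def assms(2) by blast
  have "norm (F (fwd_jump T t + p) - F (s + p) - (fwd_jump T t - s) *\<^sub>R d) \<le> e * \<bar>fwd_jump T t - s\<bar>"
    if "s \<in> T" "\<bar>s - t\<bar> < \<delta>" for s
    using \<delta>(2)[of "s + p"] assms(1) that by simp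
  then show "\<exists>\<delta>>0. \<forall>s\<in>T. \<bar>s - t\<bar> < \<delta> \<longrightarrow>
      norm (F (fwd_jump T t + p) - F (s + p) - (fwd_jump T t - s) *\<^sub>R d) \<le> e * \<bar>fwd_jump T t - s\<bar>"
    using \<delta>(1) by blast
qed

lemma delta_integral_eq:
  fixes f :: "real \<Rightarrow> 'a::real_normed_vector"
  assumes "closed T" "\<And>r. r \<in> T \<Longrightarrow> has_delta_derivative T F (f r) r" "s \<in> T" "t \<in> T"
  shows "delta_integral T f s t = F t - F s"
  unfolding delta_integral_def
proof (rule the_equality)
  show "\<exists>G. (\<forall>r\<in>T. has_delta_derivative T G (f r) r) \<and> F t - F s = G t - G s" using assms by blast
  fix I assume "\<exists>G. (\<forall>r\<in>T. has_delta_derivative T G (f r) r) \<and> I = G t - G s"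
  then obtain G where G: "\<And>r. r \<in> T \<Longrightarrow> has_delta_derivative T G (f r) r" "I = G t - G s" by blast
  have "has_delta_derivative T (\<lambda>r. F r - G r) 0 r" if "r \<in> T" for r
    using has_delta_derivative_diff[OF that assms(2)[OF that] G(1)[OF that]] by simp
  then have "F t - G t = F s - G s" by (rule delta_derivative_zero_imp_const[OF assms(1) _ assms(4,3)])
  then have "F t = F s - G s + G t" by (simp add: diff_eq_eq)
  then show "I = F t - F s" using G(2) by simp
qed

text \<open>For fixed \<open>t\<close> and an antiderivative \<open>F\<close>, the commutator of
  \<open>R t\<close> with \<open>F r\<close> has derivative \<open>0\<close> in \<open>r\<close>,
  hence equal values at \<open>s\<close> and \<open>t\<close>.\<close>

lemma commutes_with_integral_if_commuting:
  fixes R :: "real \<Rightarrow> 'a::{real_normed_field, euclidean_space}^'n^'n"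
  assumes T: "closed T" "\<And>t. t \<in> T \<Longrightarrow> \<exists>s\<in>T. t < s" and R: "rd_continuous T R"
    and comm: "\<And>s t. s \<in> T \<Longrightarrow> t \<in> T \<Longrightarrow> R s ** R t = R t ** R s"
  shows "commutes_with_integral T R"
  unfolding commutes_with_integral_def
proof (intro ballI)
  fix s t assume st: "s \<in> T" "t \<in> T"
  obtain F where F: "\<And>t. t \<in> T \<Longrightarrow> has_delta_derivative T F (R t) t"
    using rd_continuous_imp_antiderivative[OF T(1) R T(2)] by metis
  have "has_delta_derivative T (\<lambda>r. R t ** F r - F r ** R t) 0 r" if r: "r \<in> T" for r
  proof -
    have "has_delta_derivative T (\<lambda>r. R t ** F r) (R t ** R r) r"
      by (rule bounded_linear.has_delta_derivative[OF
            bounded_bilinear.bounded_linear_right[OF bounded_bilinear_matrix_mult] r F[OF r]])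
    moreover have "has_delta_derivative T (\<lambda>r. F r ** R t) (R r ** R t) r"
      by (rule bounded_linear.has_delta_derivative[OF
            bounded_bilinear.bounded_linear_left[OF bounded_bilinear_matrix_mult] r F[OF r]])
    ultimately show ?thesis
      using has_delta_derivative_diff[OF r] comm[OF st(2) r] by fastforce
  qed
  then have "R t ** F t - F t ** R t = R t ** F s - F s ** R t"
    by (rule delta_derivative_zero_imp_const[OF T(1) _ st(2,1)])
  then have "R t ** (F t - F s) = (F t - F s) ** R t"
    by (simp add: matrix_mult_diff_left matrix_mult_diff_right algebra_simps)
  moreover have "delta_integral T R s t = F t - F s"
    using F by (intro delta_integral_eq[OF T(1) _ st])
  ultimately show "R t ** delta_integral T R s t = delta_integral T R s t ** R t"
    by simp
qed

text \<open>At a point of graininess \<open>m > 0\<close> the system with coefficient \<open>(E (m / p) - I) / m\<close> steps by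
  \<open>E (m / p)\<close>; the value at \<open>0\<close> is the limit for \<open>m \<rightarrow> 0\<close>.\<close>

definition hilger_log :: "real \<Rightarrow> (real \<Rightarrow> complex^'n^'n) \<Rightarrow> complex^'n^'n \<Rightarrow> real \<Rightarrow> complex^'n^'n" where
  "hilger_log p E W m = (if m = 0 then (1 / p) *\<^sub>R W else (1 / m) *\<^sub>R (E (m / p) - mat 1))"

text \<open>Regressivity holds because \<open>mat 1 + graininess T t *\<^sub>R R t\<close> is a
  member of the group. The values of \<open>R\<close> are built from \<open>W\<close>, the identity
  and the group, all of which commute.\<close>

lemma hilger_log_system:
  fixes E :: "real \<Rightarrow> complex^'n^'n"
  assumes T: "closed T" and p: "p \<noteq> 0"
    and E: "E 0 = mat 1" "\<And>s t. E (s + t) = E s ** E t"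
    and deriv: "\<And>s. (E has_vector_derivative W ** E s) (at s)" and comm: "\<And>s. W ** E s = E s ** W"
  defines "R \<equiv> \<lambda>t. hilger_log p E W (graininess T t)"
  shows "regressive T R" "fundamental_pair T R (\<lambda>t. E (t / p)) (\<lambda>t. E (- t / p))"
    "R s ** R t = R t ** R s"
proof -
  have scaled: "((\<lambda>s. E (c * s)) has_vector_derivative c *\<^sub>R (W ** E (c * s))) (at s within S)" for c s S
  proof -
    have "((\<lambda>s. c * s) has_vector_derivative c) (at s)"
      by (auto intro!: derivative_eq_intros)
    from vector_diff_chain_at[OF this deriv]
    show ?thesis by (auto simp: o_def intro: has_vector_derivative_at_within)
  qed
  \<comment> \<open>Right continuity of the coefficient at graininess \<open>0\<close> is the
    differentiability of \<open>E\<close> at \<open>0\<close>; it yields rd-continuity of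
    \<open>R\<close>.\<close>
  have h0: "(hilger_log p E W \<longlongrightarrow> hilger_log p E W 0) (at 0 within {0..})"
  proof -
    have "((\<lambda>m. (1 / (m - 0)) *\<^sub>R (E (1 / p * m) - E (1 / p * 0))) \<longlongrightarrow> (1 / p) *\<^sub>R (W ** E (1 / p * 0))) (at 0 within {0..})"
      by (intro has_vector_derivative_imp_quotient_tendsto scaled)
    then have "((\<lambda>m. (1 / m) *\<^sub>R (E (m / p) - mat 1)) \<longlongrightarrow> hilger_log p E W 0) (at 0 within {0..})"
      by (simp add: E(1) hilger_log_def)
    then show ?thesis
      by (rule Lim_transform_eventually) (simp add: hilger_log_def eventually_at_filter)
  qed
  have step: "mat 1 + graininess T t *\<^sub>R R t = E (graininess T t / p)" for t
    by (cases "graininess T t = 0") (simp_all add: R_def hilger_log_def E(1))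
  have inv: "E (- s) ** E s = mat 1" "E s ** E (- s) = mat 1" for s
    using E(1) E(2)[of "-s" s] E(2)[of s "-s"] by simp_all
  have "invertible (E s)" for s
    using inv invertible_left_inverse by blast
  then show "regressive T R"
    unfolding regressive_def step using rd_continuous_comp_graininess[OF h0] by (simp add: R_def)
  have E_comm: "E a ** E b = E b ** E a" for a b by (metis E(2) add.commute)
  show "R s ** R t = R t ** R s"
    by (simp add: R_def hilger_log_def matrix_mult_scaleR_left matrix_mult_scaleR_right
        matrix_mult_diff_left matrix_mult_diff_right comm E_comm)
  have cont: "continuous (at t within T) (\<lambda>s. E (c * s))" for c t
    using scaled by (rule has_vector_derivative_continuous)
  have "has_delta_derivative T (\<lambda>t. E (1 / p * t)) (R t ** E (1 / p * t)) t \<and>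
      has_delta_derivative T (\<lambda>t. E (- 1 / p * t)) (- (E (- 1 / p * fwd_jump T t) ** R t)) t"
    if t: "t \<in> T" for t
  proof (cases "fwd_jump T t = t")
    case True
    then have R: "R t = (1 / p) *\<^sub>R W" by (simp add: R_def hilger_log_def graininess_def)
    show ?thesis
      using t True scaled[of "1 / p" t T] scaled[of "- 1 / p" t T]
      by (simp add: has_delta_derivative_iff R matrix_mult_scaleR_left matrix_mult_scaleR_right comm)
  next
    case False
    define m where "m = graininess T t"
    have m: "m \<noteq> 0" "fwd_jump T t = t + m" using False by (auto simp: m_def graininess_def)
    have R: "m *\<^sub>R R t = E (m / p) - mat 1" using step[of t] by (simp add: m_def algebra_simps)
    have "E (1 / p * (t + m)) = E (1 / p * t) + m *\<^sub>R (R t ** E (1 / p * t))"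
    proof -
      have "m *\<^sub>R (R t ** E (1 / p * t)) = (m *\<^sub>R R t) ** E (1 / p * t)"
        by (simp add: matrix_mult_scaleR_left)
      also have "\<dots> = E (m / p + 1 / p * t) - E (1 / p * t)"
        by (simp add: R matrix_mult_diff_left E(2))
      also have "m / p + 1 / p * t = 1 / p * (t + m)" by (simp add: add_divide_distrib)
      finally show ?thesis by simp
    qed
    \<comment> \<open>The equation of the inverse multiplies by the value after the jump, and the
      group law carries it back by \<open>m / p\<close>.\<close>
    moreover have "E (- 1 / p * (t + m)) = E (- 1 / p * t) + m *\<^sub>R (- (E (- 1 / p * (t + m)) ** R t))"
    proof -
      have "m *\<^sub>R (E (- 1 / p * (t + m)) ** R t) = E (- 1 / p * (t + m)) ** (m *\<^sub>R R t)"
        by (simp add: matrix_mult_scaleR_right)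
      also have "\<dots> = E (- 1 / p * (t + m) + m / p) - E (- 1 / p * (t + m))"
        by (simp only: R matrix_mult_diff_right E(2) matrix_mul_rid)
      also have "- 1 / p * (t + m) + m / p = - 1 / p * t" using p by (simp add: field_simps)
      finally show ?thesis by (simp only: scaleR_minus_right) simp
    qed
    ultimately show ?thesis
      using t False cont[of t "1 / p"] cont[of t "- 1 / p"]
      by (simp add: has_delta_derivative_iff m(2) flip: m_def)
  qed
  moreover have "E (- t / p) ** E (t / p) = mat 1" for t using inv(1)[of "t / p"] by simp
  ultimately show "fundamental_pair T R (\<lambda>t. E (t / p)) (\<lambda>t. E (- t / p))"
    by (simp add: fundamental_pair_def)
qed

section \<open>Complexification of real matrices and the decomposition itself\<close>

abbreviation (input) complex_matrix :: "real^'n^'m \<Rightarrow> complex^'n^'m" where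
  "complex_matrix \<equiv> map_matrix complex_of_real"

lemma bounded_linear_complex_matrix:
  "bounded_linear (complex_matrix :: real^'n^'m \<Rightarrow> complex^'n^'m)"
  unfolding linear_conv_bounded_linear[symmetric]
  by (intro linearI) (simp_all add: vec_eq_iff scaleR_conv_of_real[where 'a = complex])

lemma complex_matrix_mult: "complex_matrix (A ** B) = complex_matrix A ** complex_matrix B"
  by (simp add: vec_eq_iff matrix_matrix_mult_def)

lemma complex_matrix_1: "complex_matrix (mat 1) = mat 1"
  by (simp add: vec_eq_iff mat_def)

lemma invertible_complex_matrix:
  fixes A :: "real^'n^'n"
  assumes "invertible A"
  shows "invertible (complex_matrix A)"
proof -
  have "complex_matrix (matrix_inv A) ** complex_matrix A = mat 1"
    using invertible_matrix_inv(1)[OF assms] by (simp add: complex_matrix_1 flip: complex_matrix_mult)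
  then show ?thesis using invertible_left_inverse by blast
qed

theorem theorem3p8:
  fixes T :: "real set" and p :: real and A :: "real \<Rightarrow> real^'n^'n"
  assumes "p > 0"
    and "periodic_time_scale p T"
    and "regressive T A"
    and "periodic_on p T A"
  shows "\<exists>(R :: real \<Rightarrow> complex^'n^'n) (L :: real \<Rightarrow> complex^'n^'n).
    regressive T R \<and> commutes_with_integral T R \<and> C1_rd T L \<and>
    periodic_on p T R \<and> periodic_on p T L \<and>
    (\<forall>t\<in>T. invertible (L t)) \<and>
    (\<forall>t\<in>T. graininess T t < p \<or> invertible (A t) \<longrightarrow> invertible (R t)) \<and>
    (\<forall>t\<in>T. \<forall>\<tau>\<in>T. map_matrix complex_of_real (transition_matrix T A t \<tau>) =
       L t ** ts_exp T R t \<tau> ** matrix_inv (L \<tau>))"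
proof -
  have T: "closed T" "T \<noteq> {}" and shift: "\<And>t. t \<in> T \<Longrightarrow> t + p \<in> T"
    and gr: "\<And>t. t \<in> T \<Longrightarrow> graininess T (t + p) = graininess T t"
    "\<And>t. t \<in> T \<Longrightarrow> graininess T t \<le> p"
    using assms(2) unfolding periodic_time_scale_def time_scale_def by metis+
  have unb: "\<exists>s\<in>T. t < s" if "t \<in> T" for t using shift[OF that] assms(1) by force
  have sig_shift: "fwd_jump T (t + p) = fwd_jump T t + p" if "t \<in> T" for t
    using gr(1)[OF that] by (simp add: graininess_def)
  have A: "rd_continuous T A" "\<And>t. t \<in> T \<Longrightarrow> A (t + p) = A t"
    using assms(3,4) by (auto simp: regressive_def periodic_on_def)
  obtain t0 where t0: "t0 \<in> T" using T(2) by blast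
  obtain X Z where XZ: "fundamental_pair T A X Z"
    using regressive_fundamental_pair[OF T(1) t0 unb assms(3)] by blast
  note inv = fundamental_pair_inverse[OF XZ]
  \<comment> \<open>The monodromy matrix. By periodicity of \<open>A\<close> and of the graininess,
    the shifted \<open>X\<close> solves the same system, so uniqueness makes this one matrix serve
    every \<open>t\<close>.\<close>
  define C where "C = Z t0 ** X (t0 + p)"
  have X_shift: "X (t + p) = X t ** C" if t: "t \<in> T" for t
  proof -
    have "has_delta_derivative T (\<lambda>s. X (s + p)) (A t ** X (t + p)) t" if t: "t \<in> T" for t
    proof (rule has_delta_derivative_shift[OF shift sig_shift[OF t]])
      show "has_delta_derivative T X (A t ** X (t + p)) (t + p)"
        using XZ shift[OF t] A(2)[OF t] by (force simp: fundamental_pair_def)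
    qed
    from fundamental_pair_unique[OF T(1) XZ this t0 t]
    show ?thesis by (simp add: C_def matrix_mul_assoc)
  qed
  have "Z (t0 + p) ** X t0 ** C = mat 1"
    using X_shift[OF t0] inv(1)[OF shift[OF t0]] by (simp flip: matrix_mul_assoc)
  then have "invertible (complex_matrix C)"
    using invertible_left_inverse invertible_complex_matrix by blast
  then obtain E W where E: "E 0 = mat 1" "E 1 = complex_matrix C" "\<And>s t. E (s + t) = E s ** E t"
    and E_deriv: "\<And>s. (E has_vector_derivative W ** E s) (at s)" and W_comm: "\<And>s. W ** E s = E s ** W"
    and E_inv: "\<And>s. 0 < s \<Longrightarrow> s < 1 \<Longrightarrow> invertible (E s - mat 1)" and W_inv: "invertible W"
    by (rule matrix_real_powers) blast
  define R where "R t = hilger_log p E W (graininess T t)" for t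
  define U where "U t = E (t / p)" for t
  define V where "V t = E (- t / p)" for t
  have "p \<noteq> 0" using assms(1) by simp
  note sys = hilger_log_system[OF T(1) this E(1,3) E_deriv W_comm, folded R_def U_def V_def]
  have UV: "fundamental_pair T R U V" using sys(2) by (simp add: R_def[abs_def] U_def[abs_def] V_def[abs_def])
  have R_reg: "regressive T R" using sys(1) by (simp add: R_def[abs_def])
  note UV_inv = fundamental_pair_inverse[OF UV]
  define cX where "cX t = complex_matrix (X t)" for t
  define cZ where "cZ t = complex_matrix (Z t)" for t
  define cA where "cA t = complex_matrix (A t)" for t
  have c_inv: "cZ t ** cX t = mat 1" "cX t ** cZ t = mat 1" if "t \<in> T" for t
    using inv[OF that] by (simp_all add: cX_def cZ_def complex_matrix_1 flip: complex_matrix_mult)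
  define L where "L t = cX t ** V t" for t
  have cX_deriv: "has_delta_derivative T cX (cA t ** cX t) t" if t: "t \<in> T" for t
    using bounded_linear.has_delta_derivative[OF bounded_linear_complex_matrix t, of X "A t ** X t"] XZ t
    by (simp add: fundamental_pair_def cX_def[abs_def] cA_def complex_matrix_mult)
  \<comment> \<open>The product rule applied to \<open>cX\<close> and \<open>V\<close> expresses the
    derivative through \<open>L\<close>, \<open>cA\<close> and \<open>R\<close>, from which its
    rd-continuity can be read off.\<close>
  have L_deriv: "has_delta_derivative T L (cA t ** L t - L (fwd_jump T t) ** R t) t" if t: "t \<in> T" for t
  proof -
    have "has_delta_derivative T V (- (V (fwd_jump T t) ** R t)) t"
      using UV t by (simp add: fundamental_pair_def)
    from bounded_bilinear.has_delta_derivative[OF bounded_bilinear_matrix_mult t cX_deriv[OF t] this]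
    show ?thesis by (simp add: L_def[abs_def] matrix_mult_minus_right matrix_mul_assoc)
  qed
  have L_cont: "continuous_on T L" using L_deriv by (rule has_delta_derivative_continuous_on)
  have L_inv: "U t ** cZ t ** L t = mat 1" if t: "t \<in> T" for t
  proof -
    have "U t ** cZ t ** L t = U t ** (cZ t ** cX t) ** V t" by (simp add: L_def matrix_mul_assoc)
    then show ?thesis using c_inv[OF t] UV_inv[OF t] by simp
  qed
  have 1: "commutes_with_integral T R"
    using R_reg sys(3) unb T(1) by (intro commutes_with_integral_if_commuting) (auto simp: regressive_def R_def)
  have 2: "C1_rd T L"
  proof -
    have "rd_continuous T (\<lambda>t. cA t ** L t)"
      unfolding cA_def
      by (intro bounded_bilinear.rd_continuous[OF bounded_bilinear_matrix_mult]
          bounded_linear.rd_continuous[OF bounded_linear_complex_matrix] rd_continuous_continuous_on A(1) L_cont)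
    moreover have "rd_continuous T (\<lambda>t. L (fwd_jump T t) ** R t)"
      using R_reg by (intro bounded_bilinear.rd_continuous[OF bounded_bilinear_matrix_mult]
          rd_continuous_comp_fwd_jump T(1) L_cont) (simp add: regressive_def)
    ultimately have "rd_continuous T (\<lambda>t. cA t ** L t - L (fwd_jump T t) ** R t)"
      by (rule rd_continuous_diff)
    then show ?thesis
      using L_deriv unfolding C1_rd_def by (intro exI conjI ballI)
  qed
  have 3: "periodic_on p T R" by (simp add: periodic_on_def R_def gr(1))
  have 4: "periodic_on p T L"
    unfolding periodic_on_def
  proof
    fix t assume t: "t \<in> T"
    \<comment> \<open>One period multiplies \<open>cX\<close> by \<open>E 1\<close> on the right and
      \<open>V\<close> by \<open>E (- 1)\<close> on the left, and these cancel.\<close>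
    have "- (t + p) / p = - 1 + - t / p" using assms(1) by (simp add: field_simps)
    then have V: "V (t + p) = E (- 1) ** V t" by (simp add: V_def flip: E(3))
    have "E 1 ** E (- 1) = mat 1" using E(1) E(3)[of 1 "-1"] by simp
    moreover have "L (t + p) = cX t ** (E 1 ** E (- 1)) ** V t"
      by (simp add: L_def V cX_def X_shift[OF t] complex_matrix_mult E(2) matrix_mul_assoc)
    ultimately show "L (t + p) = L t" by (simp add: L_def)
  qed
  have 5: "invertible (L t)" if "t \<in> T" for t using L_inv[OF that] invertible_left_inverse by blast
  have 6: "invertible (R t)" if t: "t \<in> T" and or: "graininess T t < p \<or> invertible (A t)" for t
  proof -
    consider "graininess T t = 0" | "0 < graininess T t" "graininess T t < p" | "graininess T t = p" "invertible (A t)"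
      using gr(2)[OF t] or graininess_nonneg[of T t] by fastforce
    then show ?thesis
    proof cases
      case 1
      then show ?thesis using W_inv assms(1) by (simp add: R_def hilger_log_def scalar_invertible)
    next
      case 2
      then have "invertible (E (graininess T t / p) - mat 1)" using assms(1) by (intro E_inv) auto
      then show ?thesis using 2 by (simp add: R_def hilger_log_def scalar_invertible)
    next
      case 3
      \<comment> \<open>The whole period is one jump, so the delta equation determines
        \<open>X (t + p)\<close>, and with it \<open>E 1\<close>, directly from
        \<open>A t\<close>.\<close>
      then have "fwd_jump T t = t + p" by (simp add: graininess_def)
      then have "X (t + p) = X t + p *\<^sub>R (A t ** X t)"
        using has_delta_derivative_fwd_jump[OF t, of X "A t ** X t"] XZ t 3 by (simp add: fundamental_pair_def)
      then have "cX t ** E 1 = cX t + p *\<^sub>R (cA t ** cX t)"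
        using linear_add[OF bounded_linear.linear[OF bounded_linear_complex_matrix], of "X t" "p *\<^sub>R (A t ** X t)"]
          linear_scale[OF bounded_linear.linear[OF bounded_linear_complex_matrix], of p "A t ** X t"]
        by (simp add: X_shift[OF t] E(2) cA_def cX_def flip: complex_matrix_mult)
      then have "cZ t ** (cX t ** E 1) = cZ t ** (cX t + p *\<^sub>R (cA t ** cX t))" by simp
      then have "E 1 - mat 1 = p *\<^sub>R (cZ t ** cA t ** cX t)"
        using c_inv[OF t] by (simp add: matrix_mul_assoc matrix_mult_add_right matrix_mult_scaleR_right)
      then have "R t = cZ t ** cA t ** cX t" using 3(1) assms(1) by (simp add: R_def hilger_log_def)
      moreover have "invertible (cZ t)" "invertible (cX t)"
        using c_inv[OF t] by (auto simp: invertible_def)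
      moreover have "invertible (cA t)" using 3(2) by (simp add: cA_def invertible_complex_matrix)
      ultimately show ?thesis by (simp add: invertible_mult)
    qed
  qed
  have 7: "complex_matrix (transition_matrix T A t \<tau>) = L t ** ts_exp T R t \<tau> ** matrix_inv (L \<tau>)"
    if t: "t \<in> T" "\<tau> \<in> T" for t \<tau>
  proof -
    \<comment> \<open>The inverse of \<open>L \<tau>\<close> is the explicit
      \<open>U \<tau> ** cZ \<tau>\<close>; regrouping leaves two products of \<open>V\<close> and
      \<open>U\<close> that are the identity.\<close>
    have "L t ** ts_exp T R t \<tau> ** matrix_inv (L \<tau>) = L t ** (U t ** V \<tau>) ** (U \<tau> ** cZ \<tau>)"
      by (simp add: transition_matrix_eq[OF T(1) UV t] matrix_inv_eqI[OF L_inv[OF t(2)]])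
    also have "\<dots> = cX t ** (V t ** U t) ** (V \<tau> ** U \<tau>) ** cZ \<tau>"
      by (simp add: L_def matrix_mul_assoc)
    also have "\<dots> = complex_matrix (transition_matrix T A t \<tau>)"
      using UV_inv[OF t(1)] UV_inv[OF t(2)]
      by (simp add: transition_matrix_eq[OF T(1) XZ t] cX_def cZ_def complex_matrix_mult)
    finally show ?thesis by simp
  qed
  show ?thesis
    by (intro exI[of _ R] exI[of _ L] conjI R_reg 1 2 3 4 ballI impI 5 6 7)
qed

end
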